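(* Let $K$ be an imaginary quadratic field. The space $F(\mathcal{E}ll(\mathcal O_K))$ contains the Hecke theta function $\vartheta(\tau;\varphi)$ of every Hecke character $\varphi$ of $K$ of infinity type $[-1/2;1,0]$.
   Context: Fix the embedding $K\subset\mathbb C$ with $\sqrt{D_K}$ in the upper half plane $\mathcal H$, $D_K<0$ the discriminant of $K$. A Hecke character $\varphi$ of $K$ of infinity type $[-1/2;1,0]$ with conductor $\mathfrak c_f$ is (in ideal language) a homomorphism from fractional ideals of $\mathcal O_K$ prime to $\mathfrak c_f$ to $\mathbb C^\times$ such that for some character $\chi'_\varphi$ of $(\mathcal O_K/\mathfrak c_f)^\times$, $\varphi(\alpha\mathcal O_K)=\alpha\chi'_\varphi(\alpha)$ for all $\alpha\in\mathcal O_K$ prime to $\mathfrak c_f$, with $\mathfrak c_f$ minimal. Its Hecke theta function is $\vartheta(\tau;\varphi)=\sum_I\varphi(I)e^{2\pi i\tau\mathrm{Nm}(I)}$ over nonzero integral ideals $I$, with $\varphi(I)=0$ for $I$ not prime to $\mathfrak c_f$. Let $z_1,\dots,z_h\in\mathcal H$ represent the $\mathbb C$-isomorphism classes of elliptic curves $\mathbb C/(\mathbb Z+z\mathbb Z)$ with CM by $\mathcal O_K$. For $z=z_a$ let $(a_z,b_z,c_z)$ be coprime integers, $a_z>0$, with $a_zz^2+b_zz+c_z=0$. For a positive integer $f_\rho$ let $\Lambda_a$ be the lattice with basis $e_2,e_1$ and Gram matrix $f_\rho\begin{pmatrix}2a_z&b_z\\ b_z&2c_z\end{pmatrix}$, $G_{\Lambda_a}=\Lambda_a^\vee/\Lambda_a$,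 and $\Omega'_a$ the $\mathbb Q$-linear map $\Lambda_a\otimes\mathbb Q\to\mathbb C$ with $\Omega'_a(e_2)=\sqrt{2a_zf_\rho}$, $\Omega'_a(e_1)=-\sqrt{2a_zf_\rho}\,z$. For $\beta\in G_{\Lambda_a}$ let $\vartheta^{1\Omega'}_{\Lambda_a}(\tau_{ws};\beta)=\sum_{y\in\Lambda_a^\vee,\,y+\Lambda_a=\beta}\Omega'_a(y)e^{\pi i\tau_{ws}(y,y)}$ and $f_a(\tau;\beta)=\vartheta^{1\Omega'}_{\Lambda_a}(f_\rho|D_K|\tau;\beta)$. $F(\mathcal{E}ll(\mathcal O_K),f_\rho)$ is the $\mathbb C$-span of all $f_a(\tau;\beta)$, and $F(\mathcal{E}ll(\mathcal O_K))$ is the span of the union over all $f_\rho\ge1$ of the $F(\mathcal{E}ll(\mathcal O_K),f_\rho)$ (functions on $\mathcal H$). *)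

theory Defs
  imports "HOL-Analysis.Analysis" "HOL-Computational_Algebra.Squarefree"
begin

section \<open>The imaginary quadratic field K = Q(sqrt d), d < 0 squarefree, embedded in C\<close>

definition disc :: "int \<Rightarrow> int" where
  "disc d = (if d mod 4 = 1 then d else 4 * d)"

definition sqrtD :: "int \<Rightarrow> complex" where
  "sqrtD D = \<i> * complex_of_real (sqrt (real_of_int (- D)))"

definition omegaK :: "int \<Rightarrow> complex" where
  "omegaK D = (of_int D + sqrtD D) / 2"

definition OK :: "int \<Rightarrow> complex set" where
  "OK D = {of_int m + of_int n * omegaK D | m n. True}"

definition Kfield :: "int \<Rightarrow> complex set" where
  "Kfield D = {of_rat p + of_rat q * sqrtD D | p q. True}"

definition is_OK_module :: "int \<Rightarrow> complex set \<Rightarrow> bool" where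
  "is_OK_module D M \<longleftrightarrow> 0 \<in> M \<and> (\<forall>x\<in>M. \<forall>y\<in>M. x + y \<in> M) \<and> (\<forall>a\<in>OK D. \<forall>x\<in>M. a * x \<in> M)"

definition int_ideal :: "int \<Rightarrow> complex set \<Rightarrow> bool" where
  "int_ideal D I \<longleftrightarrow> is_OK_module D I \<and> I \<subseteq> OK D \<and> I \<noteq> {0}"

definition frac_ideal :: "int \<Rightarrow> complex set \<Rightarrow> bool" where
  "frac_ideal D J \<longleftrightarrow> J \<subseteq> Kfield D \<and> is_OK_module D J \<and>
     (\<exists>c\<in>OK D - {0}. int_ideal D ((*) c ` J))"

definition ideal_mult :: "int \<Rightarrow> complex set \<Rightarrow> complex set \<Rightarrow> complex set" where
  "ideal_mult D I J = {x. \<forall>M. is_OK_module D M \<and> (\<forall>a\<in>I. \<forall>b\<in>J. a * b \<in> M) \<longrightarrow> x \<in> M}"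

definition ideal_add :: "complex set \<Rightarrow> complex set \<Rightarrow> complex set" where
  "ideal_add I J = {x + y | x y. x \<in> I \<and> y \<in> J}"

definition coprime_ideal :: "int \<Rightarrow> complex set \<Rightarrow> complex set \<Rightarrow> bool" where
  "coprime_ideal D I c \<longleftrightarrow> ideal_add I c = OK D"

definition principal :: "int \<Rightarrow> complex \<Rightarrow> complex set" where
  "principal D \<alpha> = (*) \<alpha> ` OK D"

definition frac_prime_to :: "int \<Rightarrow> complex set \<Rightarrow> complex set \<Rightarrow> bool" where
  "frac_prime_to D c J \<longleftrightarrow> frac_ideal D J \<and>
     (\<exists>I1 I2. int_ideal D I1 \<and> int_ideal D I2 \<and> coprime_ideal D I1 c \<and> coprime_ideal D I2 c
        \<and> ideal_mult D I2 J = I1)"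

definition elt_prime_to :: "int \<Rightarrow> complex set \<Rightarrow> complex \<Rightarrow> bool" where
  "elt_prime_to D c \<alpha> \<longleftrightarrow> \<alpha> \<in> OK D \<and> \<alpha> \<noteq> 0 \<and> coprime_ideal D (principal D \<alpha>) c"

text \<open>a character of (O_K/c)^x, viewed as a function on elements of O_K prime to c\<close>
definition dir_char :: "int \<Rightarrow> complex set \<Rightarrow> (complex \<Rightarrow> complex) \<Rightarrow> bool" where
  "dir_char D c chr \<longleftrightarrow>
     (\<forall>\<alpha> \<beta>. elt_prime_to D c \<alpha> \<and> elt_prime_to D c \<beta> \<longrightarrow>
        chr (\<alpha> * \<beta>) = chr \<alpha> * chr \<beta> \<and> (\<alpha> - \<beta> \<in> c \<longrightarrow> chr \<alpha> = chr \<beta>)) \<and>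
     (\<forall>\<alpha>. elt_prime_to D c \<alpha> \<longrightarrow> chr \<alpha> \<noteq> 0)"

text \<open>Hecke character of infinity type [-1/2;1,0] modulo c, with finite part chi\<close>
definition hecke_mod :: "int \<Rightarrow> complex set \<Rightarrow> (complex set \<Rightarrow> complex) \<Rightarrow> (complex \<Rightarrow> complex) \<Rightarrow> bool" where
  "hecke_mod D c \<phi> chr \<longleftrightarrow> int_ideal D c \<and>
     (\<forall>J1 J2. frac_prime_to D c J1 \<and> frac_prime_to D c J2 \<longrightarrow>
        \<phi> (ideal_mult D J1 J2) = \<phi> J1 * \<phi> J2) \<and>
     (\<forall>J. frac_prime_to D c J \<longrightarrow> \<phi> J \<noteq> 0) \<and>
     dir_char D c chr \<and>
     (\<forall>\<alpha>. elt_prime_to D c \<alpha> \<longrightarrow> \<phi> (principal D \<alpha>) = \<alpha> * chr \<alpha>)"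

text \<open>phi is a Hecke character of infinity type [-1/2;1,0] with conductor exactly c\<close>
definition hecke_char_cond :: "int \<Rightarrow> complex set \<Rightarrow> (complex set \<Rightarrow> complex) \<Rightarrow> bool" where
  "hecke_char_cond D c \<phi> \<longleftrightarrow> (\<exists>chr. hecke_mod D c \<phi> chr) \<and>
     (\<forall>c' chr'. int_ideal D c' \<and> c \<subseteq> c' \<and> dir_char D c' chr' \<and>
        (\<forall>\<alpha>. elt_prime_to D c \<alpha> \<longrightarrow> \<phi> (principal D \<alpha>) = \<alpha> * chr' \<alpha>) \<longrightarrow> c' = c)"

definition ideal_norm :: "int \<Rightarrow> complex set \<Rightarrow> nat" where
  "ideal_norm D I = card ((\<lambda>x. {y \<in> OK D. x - y \<in> I}) ` OK D)"

definition hecke_theta :: "int \<Rightarrow> complex set \<Rightarrow> (complex set \<Rightarrow> complex) \<Rightarrow> complex \<Rightarrow> complex" where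
  "hecke_theta D c \<phi> \<tau> = infsum
     (\<lambda>I. (if coprime_ideal D I c then \<phi> I else 0) * exp (2 * pi * \<i> * \<tau> * of_nat (ideal_norm D I)))
     {I. int_ideal D I}"

definition lat :: "complex \<Rightarrow> complex set" where
  "lat z = {of_int m + of_int n * z | m n. True}"

definition has_CM_by_OK :: "int \<Rightarrow> complex \<Rightarrow> bool" where
  "has_CM_by_OK D z \<longleftrightarrow> Im z > 0 \<and> {w. \<forall>x\<in>lat z. w * x \<in> lat z} = OK D"

definition homothetic :: "complex \<Rightarrow> complex \<Rightarrow> bool" where
  "homothetic z1 z2 \<longleftrightarrow> (\<exists>l. l \<noteq> 0 \<and> lat z2 = (*) l ` lat z1)"

text \<open>Zs is a set of representatives z_1,...,z_h of the C-isomorphism classes\<close>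
definition CM_reps :: "int \<Rightarrow> complex set \<Rightarrow> bool" where
  "CM_reps D Zs \<longleftrightarrow> finite Zs \<and> (\<forall>z\<in>Zs. has_CM_by_OK D z) \<and>
     (\<forall>z. has_CM_by_OK D z \<longrightarrow> (\<exists>!z'. z' \<in> Zs \<and> homothetic z z'))"

definition quad_data :: "complex \<Rightarrow> int \<Rightarrow> int \<Rightarrow> int \<Rightarrow> bool" where
  "quad_data z a b c \<longleftrightarrow> gcd a (gcd b c) = 1 \<and> a > 0 \<and>
     of_int a * z ^ 2 + of_int b * z + of_int c = 0"

text \<open>vectors in Lambda_a tensor Q are written (x2, x1) = x2 e2 + x1 e1\<close>
definition gram :: "nat \<Rightarrow> int \<Rightarrow> int \<Rightarrow> int \<Rightarrow> rat \<times> rat \<Rightarrow> rat \<times> rat \<Rightarrow> rat" where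
  "gram f a b c x y = of_nat f * (2 * of_int a * fst x * fst y
      + of_int b * (fst x * snd y + snd x * fst y) + 2 * of_int c * snd x * snd y)"

definition lattL :: "(rat \<times> rat) set" where
  "lattL = {(of_int m, of_int n) | m n. True}"

definition dualL :: "nat \<Rightarrow> int \<Rightarrow> int \<Rightarrow> int \<Rightarrow> (rat \<times> rat) set" where
  "dualL f a b c = {y. \<forall>x\<in>lattL. gram f a b c y x \<in> \<int>}"

definition OmegaP :: "nat \<Rightarrow> int \<Rightarrow> complex \<Rightarrow> rat \<times> rat \<Rightarrow> complex" where
  "OmegaP f a z y = complex_of_real (sqrt (2 * real_of_int a * real f))
      * (of_rat (fst y) - of_rat (snd y) * z)"

text \<open>theta^{1 Omega'}_{Lambda_a}(tau; beta) with beta = y0 + Lambda_a, y0 in the dual lattice\<close>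
definition theta_lat :: "nat \<Rightarrow> int \<Rightarrow> int \<Rightarrow> int \<Rightarrow> complex \<Rightarrow> rat \<times> rat \<Rightarrow> complex \<Rightarrow> complex" where
  "theta_lat f a b c z y0 \<tau> = infsum
     (\<lambda>y. OmegaP f a z y * exp (pi * \<i> * \<tau> * of_rat (gram f a b c y y)))
     {y \<in> dualL f a b c. y - y0 \<in> lattL}"

definition fa :: "int \<Rightarrow> nat \<Rightarrow> int \<Rightarrow> int \<Rightarrow> int \<Rightarrow> complex \<Rightarrow> rat \<times> rat \<Rightarrow> complex \<Rightarrow> complex" where
  "fa D f a b c z y0 \<tau> = theta_lat f a b c z y0 (of_nat f * of_int \<bar>D\<bar> * \<tau>)"

definition gens :: "int \<Rightarrow> complex set \<Rightarrow> (complex \<Rightarrow> complex) set" where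
  "gens D Zs = {fa D f a b c z y0 | f a b c z y0.
      f \<ge> 1 \<and> z \<in> Zs \<and> quad_data z a b c \<and> y0 \<in> dualL f a b c}"

definition F_space :: "int \<Rightarrow> complex set \<Rightarrow> (complex \<Rightarrow> complex) set" where
  "F_space D Zs = {g. \<exists>S coef. finite S \<and> S \<subseteq> gens D Zs \<and>
      (\<forall>\<tau>. Im \<tau> > 0 \<longrightarrow> g \<tau> = (\<Sum>h\<in>S. coef h * h \<tau>))}"

end

theory Submission
  imports Defs
begin

text \<open>
  Split the Hecke theta series by ideal class. The integral ideals I whose conjugate is homothetic
  to lat z are, for a suitable integral ideal A = k lat z prime to the conductor, exactly the
  ideals with A I = (alpha) for a nonzero alpha in A, and alpha is determined up to units. Hence
  phi(I) = alpha chi(alpha) / phi(A) and Nm(I) = a |alpha|^2 / |k|^2, so the class contributes a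
  sum over alpha in A. If the positive integer f lies in the conductor, chi is constant on the
  cosets of f sqrt(D) A, of which there are finitely many in A. Since the dual of the lattice with
  Gram matrix f (2a, b; b, 2c) is lat z / (f sqrt(D)), each coset sum is a multiple of one of the
  generators of the theta space.
\<close>

section \<open>Lattices in the complex plane\<close>

text \<open>The pivot is that the product of \<open>lat z\<close> and \<open>lat (cnj z)\<close> is
  (1/a) times the ring of integers: conjugation inverts the class, so A times an ideal of the class
  of \<open>cnj z\<close> is always principal. The ideal A is manufactured from some I0 in that
  class prime to the conductor: take a nonzero x0 in I0 congruent to 1 modulo the conductor and let
  A be x0 / I0; then x0 itself lies in A and witnesses coprimality. A class without such an I0 would
  contribute zero. The factor sqrt(D) comes from the inverse different. Multiplication by f sqrt(D)
  takes dual vectors to \<open>lat z\<close> and scales squared absolute values by f^2 |D|; of this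
  factor, \<open>fa\<close> puts f |D| into the argument tau and the Gram matrix supplies the
  remaining f. Two analytic points recur. The weight alpha vanishes at 0, so 0 may be put into or
  taken out of A at will. Adding up the coset sums requires convergence, which for tau in the upper
  half plane follows from a Gaussian bound.\<close>

definition zspan :: "complex \<Rightarrow> complex \<Rightarrow> complex set" where
  "zspan u v = {of_int m * u + of_int n * v | m n. True}"

lemma lat_eq_zspan: "lat z = zspan 1 z"
  by (simp add: lat_def zspan_def)

lemma image_mult_zspan: "(*) l ` zspan u v = zspan (l * u) (l * v)"
  unfolding zspan_def
proof (intro equalityI subsetI)
  fix x assume "x \<in> (*) l ` {of_int m * u + of_int n * v | m n. True}"
  then obtain m n where "x = l * (of_int m * u + of_int n * v)" by auto
  then have "x = of_int m * (l * u) + of_int n * (l * v)" by (simp add: algebra_simps)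
  then show "x \<in> {of_int m * (l * u) + of_int n * (l * v) | m n. True}" by blast
next
  fix x assume "x \<in> {of_int m * (l * u) + of_int n * (l * v) | m n. True}"
  then obtain m n where "x = of_int m * (l * u) + of_int n * (l * v)" by auto
  then have "x = l * (of_int m * u + of_int n * v)" by (simp add: algebra_simps)
  then show "x \<in> (*) l ` {of_int m * u + of_int n * v | m n. True}" by blast
qed

lemma zspanI: "of_int m * u + of_int n * v \<in> zspan u v"
  by (auto simp: zspan_def)

lemma zspanE:
  assumes "x \<in> zspan u v"
  obtains m n where "x = of_int m * u + of_int n * v"
  using assms by (auto simp: zspan_def)

lemma zspan_base: "u \<in> zspan u v" "v \<in> zspan u v"
  using zspanI[of 1 u 0 v] zspanI[of 0 u 1 v] by auto

text \<open>\<open>Im (cnj u * v)\<close> is the signed area of the parallelogram on u and v;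
  expressing one basis in the other multiplies it by the integer determinant of the
  coordinates.\<close>

lemma covolume_dvd:
  assumes "zspan u' v' \<subseteq> zspan u v"
  shows "\<exists>n::int. Im (cnj u' * v') = of_int n * Im (cnj u * v)"
proof -
  obtain a b where u': "u' = of_int a * u + of_int b * v"
    using assms zspan_base(1) by (blast elim: zspanE)
  obtain c d where v': "v' = of_int c * u + of_int d * v"
    using assms zspan_base(2) by (blast elim: zspanE)
  have "Im (cnj u' * v') = of_int (a * d - b * c) * Im (cnj u * v)"
    unfolding u' v' by (simp add: algebra_simps)
  then show ?thesis by blast
qed

text \<open>Each area is an integer multiple of the other, so the two multipliers are inverse
  integers. This is the source of all norm computations below: ideals, units and CM lattices are
  measured by comparing two bases of one lattice.\<close>

lemma covolume_unique:
  assumes "zspan u' v' = zspan u v"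
  shows "\<bar>Im (cnj u' * v')\<bar> = \<bar>Im (cnj u * v)\<bar>"
proof -
  obtain m n :: int where
    m: "Im (cnj u' * v') = of_int m * Im (cnj u * v)" and
    n: "Im (cnj u * v) = of_int n * Im (cnj u' * v')"
    using covolume_dvd[OF equalityD1[OF assms]] covolume_dvd[OF equalityD2[OF assms]] by blast
  show ?thesis
  proof (cases "Im (cnj u * v) = 0")
    case True
    then show ?thesis using m by simp
  next
    case False
    have "of_int n * (of_int m * Im (cnj u * v)) = Im (cnj u * v)"
      by (simp only: m[symmetric] n[symmetric])
    then have "real_of_int n * real_of_int m = 1" using False by simp
    then have "real_of_int (n * m) = 1" by simp
    then have "n * m = 1" by linarith
    then have "m dvd 1" by (metis dvd_triv_right)
    then have "\<bar>m\<bar> = 1" by simp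
    then have "\<bar>real_of_int m\<bar> = 1" by linarith
    then show ?thesis unfolding m abs_mult by simp
  qed
qed

lemma lat_coords_unique:
  assumes "Im z \<noteq> 0" "of_int m + of_int n * z = of_int m' + of_int n' * z"
  shows "m = m' \<and> n = n'"
proof -
  have "n = n'" using arg_cong[OF assms(2), of Im] assms(1) by simp
  then show ?thesis using assms(2) by simp
qed

lemma latI: "of_int m + of_int n * z \<in> lat z"
  by (auto simp: lat_def)

lemma latE:
  assumes "x \<in> lat z"
  obtains m n where "x = of_int m + of_int n * z"
  using assms by (auto simp: lat_def)

lemma lat_one: "1 \<in> lat z" and lat_gen: "z \<in> lat z" and lat_zero: "0 \<in> lat z"
  using latI[of 1 0 z] latI[of 0 1 z] latI[of 0 0 z] by auto

lemma lat_of_int: "of_int m \<in> lat z"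
  using latI[of m 0 z] by simp

lemma lat_add: "x \<in> lat z \<Longrightarrow> y \<in> lat z \<Longrightarrow> x + y \<in> lat z"
proof (elim latE)
  fix m n m' n' assume "x = of_int m + of_int n * z" "y = of_int m' + of_int n' * z"
  then have "x + y = of_int (m + m') + of_int (n + n') * z" by (simp add: algebra_simps)
  then show ?thesis by (metis latI)
qed

lemma lat_int_mult: "x \<in> lat z \<Longrightarrow> of_int k * x \<in> lat z"
proof (erule latE)
  fix m n assume "x = of_int m + of_int n * z"
  then have "of_int k * x = of_int (k * m) + of_int (k * n) * z" by (simp add: algebra_simps)
  then show ?thesis by (metis latI)
qed

lemma lat_uminus: "x \<in> lat z \<Longrightarrow> - x \<in> lat z"
  using lat_int_mult[of x z "-1"] by simp

lemma lat_cnj: "x \<in> lat z \<Longrightarrow> cnj x \<in> lat (cnj z)"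
  by (elim latE) (simp add: latI)

lemma lat_cnj_eq: "lat (cnj z) = cnj ` lat z"
  using lat_cnj[of _ z] lat_cnj[of _ "cnj z"] by (force simp: image_iff)

text \<open>The imaginary part controls n, and the triangle inequality then controls m. The bound
  yields both the finiteness of bounded sets of lattice points and the convergence of theta
  series.\<close>

lemma lat_coords_bounded:
  assumes "Im z \<noteq> 0"
  obtains B where "B > 0"
    "\<And>m n. \<bar>real_of_int m\<bar> + \<bar>real_of_int n\<bar> \<le> B * norm (of_int m + of_int n * z)"
proof
  define B where "B = 1 + (1 + norm z) / \<bar>Im z\<bar>"
  show "B > 0" using assms by (auto simp: B_def add_pos_nonneg)
  fix m n :: int
  let ?u = "of_int m + of_int n * z"
  have "\<bar>of_int n * Im z\<bar> \<le> norm ?u"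
    using abs_Im_le_cmod[of ?u] by simp
  then have n: "\<bar>real_of_int n\<bar> \<le> norm ?u / \<bar>Im z\<bar>"
    using assms by (simp add: abs_mult pos_le_divide_eq)
  have "norm (of_int m :: complex) = norm (?u - of_int n * z)" by simp
  also have "\<dots> \<le> norm ?u + norm (of_int n * z)" by (rule norm_triangle_ineq4)
  finally have "\<bar>real_of_int m\<bar> \<le> norm ?u + \<bar>real_of_int n\<bar> * norm z"
    by (simp add: norm_mult)
  also have "\<dots> \<le> norm ?u + norm ?u / \<bar>Im z\<bar> * norm z"
    using n by (intro add_left_mono mult_right_mono) auto
  finally show "\<bar>real_of_int m\<bar> + \<bar>real_of_int n\<bar> \<le> B * norm ?u"
    using n by (simp add: B_def algebra_simps add_divide_distrib)
qed

lemma finite_lat_bounded: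
  assumes "Im z \<noteq> 0"
  shows "finite {x \<in> lat z. norm x \<le> R}"
proof -
  obtain B where B: "B > 0"
    "\<And>m n. \<bar>real_of_int m\<bar> + \<bar>real_of_int n\<bar> \<le> B * norm (of_int m + of_int n * z)"
    using lat_coords_bounded[OF assms] by blast
  define N where "N = \<lceil>B * R\<rceil>"
  have "{x \<in> lat z. norm x \<le> R} \<subseteq> (\<lambda>(m, n). of_int m + of_int n * z) ` ({-N..N} \<times> {-N..N})"
  proof
    fix x assume "x \<in> {x \<in> lat z. norm x \<le> R}"
    then obtain m n where x: "x = of_int m + of_int n * z" "norm x \<le> R"
      by (auto elim: latE)
    have "\<bar>real_of_int m\<bar> + \<bar>real_of_int n\<bar> \<le> B * R"
      using B(2)[of m n] mult_left_mono[OF x(2), of B] B(1) unfolding x(1) by linarith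
    then have "m \<in> {-N..N}" "n \<in> {-N..N}" unfolding N_def by simp_all linarith+
    then show "x \<in> (\<lambda>(m, n). of_int m + of_int n * z) ` ({-N..N} \<times> {-N..N})"
      using x(1) by auto
  qed
  then show ?thesis by (rule finite_subset) simp
qed

section \<open>Arithmetic of fundamental discriminants\<close>

lemma squarefree_square_dvd:
  fixes d p n :: int
  assumes "squarefree d" "p\<^sup>2 dvd d * n\<^sup>2"
  shows "p dvd n"
proof (cases "p = 0")
  case True
  have "d \<noteq> 0" using assms(1) by auto
  then show ?thesis using assms(2) True by auto
next
  case False
  \<comment> \<open>After removing the common factor, p' is coprime to n', so its square must divide
    the squarefree d, which makes p' a unit.\<close>
  define g where "g = gcd p n"
  have g: "g \<noteq> 0" using False by (simp add: g_def)
  obtain p' n' where pn: "p = p' * g" "n = n' * g" "coprime p' n'"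
    using gcd_coprime_exists[of p n] g unfolding g_def by blast
  have "p'\<^sup>2 * g\<^sup>2 dvd (d * n'\<^sup>2) * g\<^sup>2"
    using assms(2) by (simp add: pn power_mult_distrib mult.assoc)
  then have "p'\<^sup>2 dvd d * n'\<^sup>2" using g by simp
  moreover have "coprime (p'\<^sup>2) (n'\<^sup>2)" using pn(3) by simp
  ultimately have "p'\<^sup>2 dvd d" by (simp add: coprime_dvd_mult_left_iff)
  then have "is_unit p'" using assms(1) by (auto simp: squarefree_def)
  then show ?thesis using pn by (metis dvd_mult_unit_iff dvd_refl dvd_triv_right mult.commute mult_unit_dvd_iff)
qed

text \<open>This is the maximality of the order with basis 1, omega in integer form. An element w
  with trace t, norm s and p w = m + n omega satisfies the hypothesis, since both sides are p^2
  times the square of the difference between w and its conjugate. The conclusion says that w = j + k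
  omega with integers k and j = (t - k D) / 2.\<close>

lemma disc_index_dvd:
  fixes d p n t s :: int
  assumes "squarefree d" "p \<noteq> 0" "disc d * n\<^sup>2 = p\<^sup>2 * (t\<^sup>2 - 4 * s)"
  shows "\<exists>k. n = p * k \<and> even (t - k * disc d)"
proof (cases "d mod 4 = 1")
  case True
  then have D: "disc d = d" by (simp add: disc_def)
  have "p\<^sup>2 dvd d * n\<^sup>2" using assms(3) unfolding D by (metis dvd_triv_left)
  then have "p dvd n" by (rule squarefree_square_dvd[OF assms(1)])
  then obtain k where k: "n = p * k" by blast
  have "d * k\<^sup>2 = t\<^sup>2 - 4 * s" using assms(2,3) D by (simp add: k power_mult_distrib)
  moreover have "odd d" using True by presburger
  ultimately have "even (d * k\<^sup>2) \<longleftrightarrow> even (t\<^sup>2)" by simp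
  then have "even k \<longleftrightarrow> even t" using \<open>odd d\<close> by simp
  then show ?thesis using k D \<open>odd d\<close> by auto
next
  case False
  then have D: "disc d = 4 * d" by (simp add: disc_def)
  have "\<not> 4 dvd d"
  proof
    assume "4 dvd d"
    then have "(2::int)\<^sup>2 dvd d" by simp
    then have "is_unit (2::int)" using assms(1) unfolding squarefree_def by blast
    then show False by simp
  qed
  have eq: "d * (2 * n)\<^sup>2 = p\<^sup>2 * (t\<^sup>2 - 4 * s)" using assms(3) D by (simp add: power_mult_distrib)
  then have "p\<^sup>2 dvd d * (2 * n)\<^sup>2" by (metis dvd_triv_left)
  then have "p dvd 2 * n" by (rule squarefree_square_dvd[OF assms(1)])
  then obtain k where k: "2 * n = p * k" by blast
  have dk: "d * k\<^sup>2 = t\<^sup>2 - 4 * s" using eq assms(2) by (simp add: k power_mult_distrib)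
  have sq: "x\<^sup>2 mod 4 = (if even x then 0 else 1)" for x :: int
  proof (cases "even x")
    case True
    then obtain y where "x = 2 * y" by blast
    then show ?thesis by (simp add: power_mult_distrib)
  next
    case False
    then obtain y where "x = 2 * y + 1" by (blast elim: oddE)
    then have "x\<^sup>2 = 4 * (y\<^sup>2 + y) + 1" by (simp add: power2_eq_square algebra_simps)
    then show ?thesis using False by presburger
  qed
  have m: "((d mod 4) * (k\<^sup>2 mod 4)) mod 4 = t\<^sup>2 mod 4"
  proof -
    have "(d * k\<^sup>2) mod 4 = t\<^sup>2 mod 4" unfolding dk by presburger
    then show ?thesis by (simp add: mod_mult_eq)
  qed
  \<comment> \<open>Squares are 0 or 1 modulo 4, so d k^2 = t^2 modulo 4 with d equal to 2 or 3
    there is impossible for odd k; hence k is even, and then t is.\<close>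
  have "d mod 4 = 2 \<or> d mod 4 = 3" using False \<open>\<not> 4 dvd d\<close> by presburger
  then have "even k" "even t" using m sq[of k] sq[of t] by (auto split: if_splits)
  then obtain j where "k = 2 * j" by blast
  then have "n = p * j" using k by simp
  then show ?thesis using \<open>even t\<close> D by auto
qed

section \<open>Ideals of the maximal order\<close>

lemma OK_eq_lat: "OK D = lat (omegaK D)"
  by (simp add: OK_def lat_def)

lemma is_OK_moduleD:
  assumes "is_OK_module D M"
  shows "0 \<in> M" "x \<in> M \<Longrightarrow> y \<in> M \<Longrightarrow> x + y \<in> M" "a \<in> OK D \<Longrightarrow> x \<in> M \<Longrightarrow> a * x \<in> M"
  using assms by (auto simp: is_OK_module_def)

lemma is_OK_module_int_mult:
  assumes "is_OK_module D M" "x \<in> M"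
  shows "of_int k * x \<in> M"
  using is_OK_moduleD(3)[OF assms(1) _ assms(2)] lat_of_int unfolding OK_eq_lat by blast

lemma is_OK_module_diff:
  assumes "is_OK_module D M" "x \<in> M" "y \<in> M"
  shows "x - y \<in> M"
  using is_OK_moduleD(2)[OF assms(1) assms(2) is_OK_module_int_mult[OF assms(1,3), of "-1"]] by simp

lemma is_OK_module_image_mult:
  assumes "is_OK_module D M"
  shows "is_OK_module D ((*) l ` M)"
  unfolding is_OK_module_def
proof (intro conjI ballI)
  show "0 \<in> (*) l ` M" using is_OK_moduleD(1)[OF assms] by force
next
  fix x y assume "x \<in> (*) l ` M" "y \<in> (*) l ` M"
  then obtain x' y' where "x = l * x'" "y = l * y'" "x' \<in> M" "y' \<in> M" by blast
  then show "x + y \<in> (*) l ` M"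
    using is_OK_moduleD(2)[OF assms, of x' y'] by (metis distrib_left imageI)
next
  fix a x assume "a \<in> OK D" "x \<in> (*) l ` M"
  then obtain x' where "x = l * x'" "x' \<in> M" by blast
  then show "a * x \<in> (*) l ` M"
    using is_OK_moduleD(3)[OF assms \<open>a \<in> OK D\<close>, of x'] by (metis mult.left_commute imageI)
qed

locale imaginary_quadratic =
  fixes d D :: int
  assumes d_neg: "d < 0" and d_squarefree: "squarefree d" and D_disc: "D = disc d"
begin

abbreviation "\<omega> \<equiv> omegaK D"

lemma D_neg: "D < 0"
  using d_neg by (simp add: D_disc disc_def)

text \<open>The number e is the norm of omega, whose minimal polynomial is X^2 - D X + e.\<close>

lemma D_cong: obtains e where "D * D - D = 4 * e"
proof (cases "d mod 4 = 1")
  case True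
  then obtain k where "D = 4 * k + 1" using D_disc disc_def[of d]
    by (metis mult_div_mod_eq)
  then have "D * D - D = 4 * (4 * k * k + k)" by (simp add: algebra_simps)
  then show ?thesis by (rule that)
next
  case False
  then have "D = 4 * d" by (simp add: D_disc disc_def)
  then have "D * D - D = 4 * (4 * d * d - d)" by (simp add: algebra_simps)
  then show ?thesis by (rule that)
qed

lemma sqrtD_square: "sqrtD D * sqrtD D = of_int D"
proof -
  have "complex_of_real (sqrt (of_int (- D))) * complex_of_real (sqrt (of_int (- D))) = of_int (- D)"
    using D_neg by (simp flip: of_real_mult)
  then show ?thesis unfolding sqrtD_def by (simp add: algebra_simps)
qed

lemma sqrtD_nonzero: "sqrtD D \<noteq> 0"
  using sqrtD_square D_neg by auto

lemma sqrtD_omega: "sqrtD D = 2 * \<omega> - of_int D"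
  by (simp add: omegaK_def field_simps)

lemma sqrtD_in_OK: "sqrtD D \<in> OK D"
  using latI[of "- D" 2 \<omega>] unfolding OK_eq_lat sqrtD_omega by simp

lemma Im_omega: "Im \<omega> = sqrt (of_int (- D)) / 2" and Re_omega: "Re \<omega> = of_int D / 2"
  by (simp_all add: omegaK_def sqrtD_def)

lemma Im_omega_pos: "Im \<omega> > 0"
  using D_neg by (simp add: Im_omega)

lemma cnj_omega: "cnj \<omega> = of_int D - \<omega>"
  by (rule complex_eqI) (simp_all add: Re_omega)

lemma omega_square:
  assumes "D * D - D = 4 * e"
  shows "\<omega> * \<omega> = of_int D * \<omega> - of_int e"
proof -
  have "4 * (\<omega> * \<omega>) = (of_int D + sqrtD D) * (of_int D + sqrtD D)"
    by (simp add: omegaK_def)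
  also have "\<dots> = of_int D * of_int D + of_int D + 2 * of_int D * sqrtD D"
    using sqrtD_square by (simp add: algebra_simps)
  also have "\<dots> = 4 * (of_int D * \<omega>) - of_int (D * D - D)"
    by (simp add: omegaK_def algebra_simps)
  also have "\<dots> = 4 * (of_int D * \<omega> - of_int e)"
    unfolding assms by simp
  finally show ?thesis by (simp only: mult_cancel_left) simp
qed

lemma OK_mult: "x \<in> OK D \<Longrightarrow> y \<in> OK D \<Longrightarrow> x * y \<in> OK D"
  unfolding OK_eq_lat
proof (elim latE)
  fix m n m' n' assume xy: "x = of_int m + of_int n * \<omega>" "y = of_int m' + of_int n' * \<omega>"
  obtain e where e: "D * D - D = 4 * e" by (rule D_cong)
  have "x * y = of_int m * of_int m' + (of_int m * of_int n' + of_int m' * of_int n) * \<omega>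
      + of_int n * of_int n' * (\<omega> * \<omega>)"
    unfolding xy by (simp add: algebra_simps)
  also have "\<dots> = of_int (m * m' - n * n' * e) + of_int (m * n' + m' * n + n * n' * D) * \<omega>"
    unfolding omega_square[OF e] by (simp add: algebra_simps)
  finally show "x * y \<in> lat \<omega>" by (simp only: latI)
qed

lemma OK_cnj: "x \<in> OK D \<Longrightarrow> cnj x \<in> OK D"
  unfolding OK_eq_lat
proof (elim latE)
  fix m n assume "x = of_int m + of_int n * \<omega>"
  then have "cnj x = of_int (m + n * D) + of_int (- n) * \<omega>"
    by (simp add: cnj_omega algebra_simps)
  then show "cnj x \<in> lat \<omega>" by (simp only: latI)
qed

lemma OK_module: "is_OK_module D (OK D)"
  using OK_mult lat_add lat_zero unfolding is_OK_module_def by (simp add: OK_eq_lat)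

lemma OK_one: "1 \<in> OK D"
  by (simp add: OK_eq_lat lat_one)

text \<open>The product is real and lies in the ring, so its omega coordinate vanishes.\<close>

lemma OK_norm:
  assumes "x \<in> OK D" "x \<noteq> 0"
  obtains k :: int where "k > 0" "x * cnj x = of_int k"
proof -
  have "x * cnj x \<in> OK D" using assms OK_mult OK_cnj by blast
  then obtain m n where mn: "x * cnj x = of_int m + of_int n * \<omega>"
    unfolding OK_eq_lat by (rule latE)
  have "of_int n * Im \<omega> = 0" using arg_cong[OF mn, of Im] by simp
  then have n: "n = 0" using Im_omega_pos by simp
  then have "x * cnj x = of_int m" using mn by simp
  moreover have "complex_of_real ((norm x)\<^sup>2) = x * cnj x" by (rule complex_norm_square)
  ultimately have "complex_of_real ((norm x)\<^sup>2) = complex_of_real (of_int m)" by simp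
  then have "(norm x)\<^sup>2 = of_int m" using of_real_eq_iff by blast
  then have "real_of_int m > 0" using assms(2) by (metis zero_less_norm_iff zero_less_power)
  then have "m > 0" by simp
  then show ?thesis using that \<open>x * cnj x = of_int m\<close> by blast
qed

lemma int_ideal_pos_int:
  assumes "int_ideal D I"
  obtains k :: int where "k > 0" "of_int k \<in> I"
proof -
  have M: "is_OK_module D I" and sub: "I \<subseteq> OK D" using assms by (auto simp: int_ideal_def)
  obtain x where x: "x \<in> I" "x \<noteq> 0"
    using assms is_OK_moduleD(1)[OF M] by (auto simp: int_ideal_def)
  obtain k :: int where "k > 0" "x * cnj x = of_int k" using OK_norm x sub by blast
  moreover have "cnj x * x \<in> I" using is_OK_moduleD(3)[OF M OK_cnj x(1)] x sub by blast
  ultimately show ?thesis using that by (simp add: mult.commute)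
qed

text \<open>Hermite normal form: p generates the rational integers in I, r generates the omega
  coordinates of elements of I, and q + r omega is an element attaining r. Putting it as a
  membership test makes both the basis and the index of I easy to read off.\<close>

lemma int_ideal_basis:
  assumes "int_ideal D I"
  obtains p q r :: int where "p > 0" "r > 0"
    "\<And>m n. of_int m + of_int n * \<omega> \<in> I \<longleftrightarrow> r dvd n \<and> p dvd m - (n div r) * q"
proof -
  have M: "is_OK_module D I" and sub: "I \<subseteq> OK D" using assms by (auto simp: int_ideal_def)
  obtain k0 :: int where k0: "k0 > 0" "of_int k0 \<in> I" by (rule int_ideal_pos_int[OF assms])
  define p where "p = (LEAST n. n > 0 \<and> (of_nat n :: complex) \<in> I)"
  have p: "p > 0 \<and> (of_nat p :: complex) \<in> I"
    unfolding p_def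
    by (rule LeastI[of _ "nat k0"]) (use k0 in \<open>simp add: of_nat_nat\<close>)
  have p_min: "p \<le> n" if "n > 0" "(of_nat n :: complex) \<in> I" for n
    unfolding p_def using that by (intro Least_le) auto
  define Q where "Q r \<longleftrightarrow> (\<exists>q::int. of_int q + of_nat r * \<omega> \<in> I)" for r :: nat
  define r where "r = (LEAST n. n > 0 \<and> Q n)"
  have "of_int k0 * \<omega> \<in> I"
    using is_OK_moduleD(3)[OF M _ k0(2), of \<omega>] lat_gen[of \<omega>] unfolding OK_eq_lat
    by (simp add: mult.commute)
  then have "Q (nat k0)" using k0 by (auto simp: Q_def of_nat_nat intro!: exI[of _ 0])
  then have r: "r > 0 \<and> Q r"
    using LeastI[of "\<lambda>n. n > 0 \<and> Q n" "nat k0"] k0 unfolding r_def by simp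
  have r_min: "r \<le> n" if "n > 0" "Q n" for n
    unfolding r_def using that by (intro Least_le) auto
  obtain q :: int where q: "of_int q + of_nat r * \<omega> \<in> I" using r by (auto simp: Q_def)
  have pdvd: "of_int m \<in> I \<longleftrightarrow> int p dvd m" for m :: int
  proof
    assume m: "of_int m \<in> I"
    have "of_int m - of_int (m div int p) * of_nat p \<in> I"
      using p m by (intro is_OK_module_diff[OF M] is_OK_module_int_mult[OF M]) auto
    moreover have "of_int m - of_int (m div int p) * of_nat p = (of_nat (nat (m mod int p)) :: complex)"
    proof -
      have "(of_int m - of_int (m div int p) * of_nat p :: complex) = of_int (m - m div int p * int p)"
        by simp
      also have "\<dots> = of_int (m mod int p)" by (simp only: minus_div_mult_eq_mod)
      finally show ?thesis using p by (simp add: of_nat_nat)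
    qed
    ultimately have "(of_nat (nat (m mod int p)) :: complex) \<in> I" by simp
    moreover have "nat (m mod int p) < p" using p by (simp add: nat_less_iff)
    ultimately have "\<not> nat (m mod int p) > 0"
      using p_min[of "nat (m mod int p)"] by linarith
    then have "m mod int p = 0" using p by (simp add: order_antisym)
    then show "int p dvd m" by auto
  next
    assume "int p dvd m"
    then obtain j where "m = j * int p" by (metis dvd_def mult.commute)
    then show "of_int m \<in> I" using is_OK_module_int_mult[OF M, of "of_nat p" j] p by simp
  qed
  have main: "of_int m + of_int n * \<omega> \<in> I \<longleftrightarrow> int r dvd n \<and> int p dvd m - (n div int r) * q" for m n
  proof
    assume x: "of_int m + of_int n * \<omega> \<in> I"
    define k where "k = n div int r"
    \<comment> \<open>Subtracting a multiple of q + r omega leaves an omega coordinate below r,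
      which minimality of r forces to be zero; what remains is a rational integer in I.\<close>
    have y: "(of_int m + of_int n * \<omega>) - of_int k * (of_int q + of_nat r * \<omega>) \<in> I"
      using x q by (intro is_OK_module_diff[OF M] is_OK_module_int_mult[OF M]) auto
    have nm: "n - k * int r = n mod int r" by (simp add: k_def minus_div_mult_eq_mod)
    have eq: "(of_int m + of_int n * \<omega>) - of_int k * (of_int q + of_nat r * \<omega>)
      = of_int (m - k * q) + of_int (n - k * int r) * \<omega>" by (simp add: algebra_simps)
    have "of_int (m - k * q) + of_nat (nat (n mod int r)) * \<omega> \<in> I"
      using y r unfolding eq nm by (simp add: of_nat_nat)
    then have "Q (nat (n mod int r))" unfolding Q_def by blast
    moreover have "nat (n mod int r) < r" using r by (simp add: nat_less_iff)
    ultimately have "\<not> nat (n mod int r) > 0"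
      using r_min[of "nat (n mod int r)"] by linarith
    then have n0: "n mod int r = 0" using r by (simp add: order_antisym)
    then have "of_int (m - k * q) \<in> I" using y unfolding eq nm by simp
    then have "int p dvd m - k * q" by (simp only: pdvd)
    then show "int r dvd n \<and> int p dvd m - (n div int r) * q"
      using n0 unfolding k_def by (simp add: mod_eq_0_iff_dvd)
  next
    assume *: "int r dvd n \<and> int p dvd m - (n div int r) * q"
    have "of_int (m - (n div int r) * q) + of_int (n div int r) * (of_int q + of_nat r * \<omega>) \<in> I"
    proof (rule is_OK_moduleD(2)[OF M _ is_OK_module_int_mult[OF M q]])
      show "of_int (m - (n div int r) * q) \<in> I" using * by (simp only: pdvd)
    qed
    moreover have "of_int (m - (n div int r) * q) + of_int (n div int r) * (of_int q + of_nat r * \<omega>)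
      = of_int m + of_int (n div int r * int r) * \<omega>" by (simp add: algebra_simps)
    moreover have "n div int r * int r = n" using * by simp
    ultimately show "of_int m + of_int n * \<omega> \<in> I" by (simp only:)
  qed
  show ?thesis by (rule that[of "int p" "int r" q]) (use p r main in auto)
qed

lemma int_ideal_zspan:
  fixes p q r :: int
  assumes "int_ideal D I" "p > 0" "r > 0"
    "\<And>m n. of_int m + of_int n * \<omega> \<in> I \<longleftrightarrow> r dvd n \<and> p dvd m - (n div r) * q"
  shows "I = zspan (of_int p) (of_int q + of_int r * \<omega>)"
proof (intro equalityI subsetI)
  fix x assume x: "x \<in> I"
  then have "x \<in> lat \<omega>" using assms(1) by (auto simp: int_ideal_def OK_eq_lat)
  then obtain m n where mn: "x = of_int m + of_int n * \<omega>" by (rule latE)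
  then have "r dvd n" "p dvd m - (n div r) * q" using x assms(4) by auto
  then obtain j k where j: "n = r * j" and k: "m - (n div r) * q = p * k" by (metis dvdE)
  have "m = p * k + j * q" using j k assms(3) by simp
  then have "x = of_int k * of_int p + of_int j * (of_int q + of_int r * \<omega>)"
    by (simp add: mn j algebra_simps)
  then show "x \<in> zspan (of_int p) (of_int q + of_int r * \<omega>)" by (simp only: zspanI)
next
  fix x assume "x \<in> zspan (of_int p) (of_int q + of_int r * \<omega>)"
  then obtain k j where "x = of_int k * of_int p + of_int j * (of_int q + of_int r * \<omega>)"
    by (rule zspanE)
  then have "x = of_int (k * p + j * q) + of_int (j * r) * \<omega>" by (simp add: algebra_simps)
  moreover have "of_int (k * p + j * q) + of_int (j * r) * \<omega> \<in> I"
    using assms(3) unfolding assms(4) by simp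
  ultimately show "x \<in> I" by simp
qed

text \<open>The points i + j omega with i below p and j below r represent each residue class
  once.\<close>

lemma ideal_norm_basis:
  fixes p q r :: int
  assumes "int_ideal D I" "p > 0" "r > 0"
    "\<And>m n. of_int m + of_int n * \<omega> \<in> I \<longleftrightarrow> r dvd n \<and> p dvd m - (n div r) * q"
  shows "int (ideal_norm D I) = p * r"
proof -
  have M: "is_OK_module D I" using assms(1) by (auto simp: int_ideal_def)
  define cls where "cls x = {y \<in> OK D. x - y \<in> I}" for x
  define pt where "pt = (\<lambda>(i :: int, j :: int). of_int i + of_int j * \<omega>)"
  have cls_eq: "cls x = cls y \<longleftrightarrow> x - y \<in> I" if "x \<in> OK D" "y \<in> OK D" for x y
  proof
    assume "cls x = cls y"
    moreover have "y \<in> cls y" using that is_OK_moduleD(1)[OF M] by (simp add: cls_def)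
    ultimately have "y \<in> cls x" by simp
    then show "x - y \<in> I" by (simp add: cls_def)
  next
    assume xy: "x - y \<in> I"
    have "x - z \<in> I \<longleftrightarrow> y - z \<in> I" for z
      using is_OK_module_diff[OF M _ xy, of "x - z"] is_OK_moduleD(2)[OF M xy, of "y - z"]
      by (auto simp: algebra_simps)
    then show "cls x = cls y" by (simp add: cls_def)
  qed
  have pt_OK: "pt ij \<in> OK D" for ij
    by (cases ij) (simp add: pt_def OK_eq_lat latI)
  have pt_diff: "pt (i, j) - pt (i', j') = of_int (i - i') + of_int (j - j') * \<omega>" for i j i' j'
    by (simp add: pt_def algebra_simps)
  have "cls ` OK D = (cls \<circ> pt) ` ({0..<p} \<times> {0..<r})"
  proof (intro equalityI subsetI)
    fix X assume "X \<in> cls ` OK D"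
    then obtain x where x: "x \<in> OK D" "X = cls x" by blast
    obtain m n where mn: "x = of_int m + of_int n * \<omega>" using x(1) unfolding OK_eq_lat by (rule latE)
    define j where "j = n mod r"
    \<comment> \<open>Reducing n modulo r subtracts \<open>n div r\<close> copies of q + r omega,
      which shifts the first coordinate by \<open>(n div r) * q\<close> before it is reduced modulo
      p.\<close>
    define i where "i = (m - (n div r) * q) mod p"
    have nj: "n - j = r * (n div r)" by (simp add: j_def minus_mod_eq_mult_div)
    have "p dvd (m - (n div r) * q) - i" unfolding i_def by (rule dvd_minus_mod)
    moreover have "(m - (n div r) * q) - i = (m - i) - (n div r) * q" by simp
    ultimately have "p dvd (m - i) - (n div r) * q" by (simp only:)
    moreover have "(n - j) div r = n div r" using nj assms(3) by simp
    ultimately have "pt (m, n) - pt (i, j) \<in> I"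
      unfolding pt_diff assms(4) using nj by simp
    then have "cls x = cls (pt (i, j))"
      using cls_eq[OF x(1) pt_OK, of "(i, j)"] by (simp add: pt_def mn)
    moreover have "(i, j) \<in> {0..<p} \<times> {0..<r}" using assms(2,3) by (simp add: i_def j_def)
    ultimately show "X \<in> (cls \<circ> pt) ` ({0..<p} \<times> {0..<r})" using x(2) by (metis comp_apply imageI)
  next
    fix X assume "X \<in> (cls \<circ> pt) ` ({0..<p} \<times> {0..<r})"
    then show "X \<in> cls ` OK D" using pt_OK by auto
  qed
  moreover have "inj_on (cls \<circ> pt) ({0..<p} \<times> {0..<r})"
  proof (rule inj_onI, clarify)
    fix i j i' j'
    assume ij: "i \<in> {0..<p}" "j \<in> {0..<r}" "i' \<in> {0..<p}" "j' \<in> {0..<r}"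
      and eq: "(cls \<circ> pt) (i, j) = (cls \<circ> pt) (i', j')"
    then have "pt (i, j) - pt (i', j') \<in> I" using cls_eq[OF pt_OK pt_OK] by auto
    then have *: "r dvd j - j'" "p dvd (i - i') - ((j - j') div r) * q"
      unfolding pt_diff assms(4) by auto
    have z: "x = y" if "k dvd x - y" "x \<in> {0..<k}" "y \<in> {0..<k}" for k x y :: int
      using that by (metis atLeastLessThan_iff mod_eq_dvd_iff mod_pos_pos_trivial)
    have "j = j'" using z *(1) ij by blast
    moreover have "i = i'" using z[of p i i'] *(2) ij \<open>j = j'\<close> by simp
    ultimately show "i = i' \<and> j = j'" by simp
  qed
  ultimately have "card (cls ` OK D) = card ({0..<p} \<times> {0..<r})" by (simp only: card_image)
  also have "\<dots> = nat p * nat r" by simp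
  finally show ?thesis using assms(2,3) by (simp add: ideal_norm_def cls_def)
qed

text \<open>The index is a ratio of covolumes, so an arbitrary basis of I may replace the normal
  form.\<close>

lemma ideal_norm_covolume:
  assumes "int_ideal D I" "I = zspan u v"
  shows "of_nat (ideal_norm D I) * Im \<omega> = \<bar>Im (cnj u * v)\<bar>"
proof -
  obtain p q r :: int where b: "p > 0" "r > 0"
    "\<And>m n. of_int m + of_int n * \<omega> \<in> I \<longleftrightarrow> r dvd n \<and> p dvd m - (n div r) * q"
    by (rule int_ideal_basis[OF assms(1)]) blast
  have "zspan (of_int p) (of_int q + of_int r * \<omega>) = zspan u v"
    using int_ideal_zspan[OF assms(1) b] assms(2) by simp
  from covolume_unique[OF this]
  have "\<bar>of_int p * (of_int r * Im \<omega>)\<bar> = \<bar>Im (cnj u * v)\<bar>" by simp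
  moreover have "real (ideal_norm D I) = of_int p * of_int r"
    using ideal_norm_basis[OF assms(1) b] by (metis of_int_mult of_int_of_nat_eq)
  ultimately show ?thesis using b Im_omega_pos by simp
qed

end

section \<open>CM points and quadratic forms\<close>

context imaginary_quadratic
begin

text \<open>Multiplication by w acts on the basis 1, z through an integer matrix, so w is a
  quadratic integer; the rational relation between z and omega places it in K, and
  \<open>disc_index_dvd\<close> then gives integral coordinates.\<close>

lemma multiplier_in_OK:
  fixes p q r :: int
  assumes p: "p > 0" and z: "of_int p * z = of_int q + of_int r * \<omega>" and "Im z \<noteq> 0"
    and w: "w \<in> lat z" "w * z \<in> lat z"
  shows "w \<in> OK D"
proof -
  obtain a b where ab: "w = of_int a + of_int b * z" using w(1) by (rule latE)
  obtain a' b' where ab': "w * z = of_int a' + of_int b' * z" using w(2) by (rule latE)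
  show ?thesis
  proof (cases "b = 0")
    case True
    then show ?thesis using ab lat_of_int by (simp add: OK_eq_lat)
  next
    case False
    have Imw: "Im w \<noteq> 0" using ab False assms(3) by simp
    \<comment> \<open>Trace and determinant of multiplication by w in the basis 1, z; the equation
      derived next is Cayley-Hamilton.\<close>
    define t where "t = a + b'"
    define s where "s = a * b' - b * a'"
    have "(w - of_int a) * (w - of_int b') = of_int b * (w * z - of_int b' * z)"
      unfolding ab by (simp add: algebra_simps)
    also have "\<dots> = of_int b * of_int a'" unfolding ab' by simp
    finally have eq: "w * w - of_int t * w + of_int s = 0"
      by (simp add: t_def s_def algebra_simps)
    have "Im w * (2 * Re w - of_int t) = 0"
      using arg_cong[OF eq, of Im] by (simp add: algebra_simps)
    then have Re: "2 * Re w = of_int t" using Imw by simp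
    have "Re w * Re w - Im w * Im w - of_int t * Re w + of_int s = 0"
      using arg_cong[OF eq, of Re] by simp
    then have s: "Re w * Re w + Im w * Im w = of_int s"
      unfolding Re[symmetric] by (simp add: algebra_simps)
    define m where "m = p * a + b * q"
    define n where "n = b * r"
    have pw: "of_int p * w = of_int m + of_int n * \<omega>"
    proof -
      have "of_int p * w = of_int (p * a) + of_int b * (of_int p * z)"
        unfolding ab by (simp add: algebra_simps)
      then show ?thesis unfolding z m_def n_def by (simp add: algebra_simps)
    qed
    have rp: "of_int p * Re w = of_int m + of_int n * (of_int D / 2)"
      using arg_cong[OF pw, of Re] by (simp add: Re_omega)
    have ip: "of_int p * Im w = of_int n * Im \<omega>"
      using arg_cong[OF pw, of Im] by simp
    have Imsq: "4 * (Im \<omega> * Im \<omega>) = - of_int D"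
      using D_neg by (simp add: Im_omega)
    \<comment> \<open>Since 4 (Im w)^2 = 4 s - t^2, squaring the imaginary parts of p w = m + n
      omega gives p^2 (4 s - t^2) = - n^2 D.\<close>
    have "of_int p * of_int p * (4 * (Im w * Im w)) = of_int n * of_int n * (4 * (Im \<omega> * Im \<omega>))"
      using arg_cong2[OF ip ip, of "(*)"] by (simp add: algebra_simps)
    then have "of_int p * of_int p * (4 * of_int s - (2 * Re w) * (2 * Re w)) = - (of_int n * of_int n * of_int D)"
      unfolding Imsq s[symmetric] by (simp add: algebra_simps)
    then have "real_of_int (p * p * (4 * s - t * t)) = of_int (- (n * n * D))"
      unfolding Re by simp
    then have "p * p * (4 * s - t * t) = - (n * n * D)" by (simp only: of_int_eq_iff)
    then have "disc d * n\<^sup>2 = p\<^sup>2 * (t\<^sup>2 - 4 * s)"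
      unfolding D_disc[symmetric] by (simp add: power2_eq_square algebra_simps)
    then obtain k where k: "n = p * k" "even (t - k * disc d)"
      using disc_index_dvd[OF d_squarefree, of p n t s] p by blast
    then obtain j where j: "t - k * D = 2 * j" unfolding D_disc[symmetric] by blast
    have "w = of_int j + of_int k * \<omega>"
    proof (rule complex_eqI)
      have "of_int t - of_int k * of_int D = 2 * real_of_int j"
        using arg_cong[OF j, of real_of_int] by simp
      then show "Re w = Re (of_int j + of_int k * \<omega>)" using Re by (simp add: Re_omega)
      show "Im w = Im (of_int j + of_int k * \<omega>)" using ip p by (simp add: k(1))
    qed
    then show ?thesis by (simp add: OK_eq_lat latI)
  qed
qed

text \<open>Divide the normal form basis by p, so that z = (q + r omega) / p. The lattice is stable
  under the ring because I is, and \<open>multiplier_in_OK\<close> shows that nothing larger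
  stabilizes it.\<close>

lemma int_ideal_CM:
  assumes "int_ideal D I"
  obtains z l where "has_CM_by_OK D z" "l \<noteq> 0" "I = (*) l ` lat z"
proof -
  obtain p q r :: int where b: "p > 0" "r > 0"
    "\<And>m n. of_int m + of_int n * \<omega> \<in> I \<longleftrightarrow> r dvd n \<and> p dvd m - (n div r) * q"
    by (rule int_ideal_basis[OF assms]) blast
  define z where "z = (of_int q + of_int r * \<omega>) / of_int p"
  have pz: "of_int p * z = of_int q + of_int r * \<omega>" using b by (simp add: z_def)
  have Iz: "I = (*) (of_int p) ` lat z"
    using int_ideal_zspan[OF assms b] by (simp add: lat_eq_zspan image_mult_zspan pz)
  have "of_int p * Im z = of_int r * Im \<omega>" using arg_cong[OF pz, of Im] by simp
  then have "0 < of_int p * Im z" using b(2) Im_omega_pos by simp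
  then have Imz: "Im z > 0" using b(1) by (simp add: zero_less_mult_iff)
  have mod: "w * x \<in> lat z" if "w \<in> OK D" "x \<in> lat z" for w x
  proof -
    have "is_OK_module D I" using assms by (simp add: int_ideal_def)
    then have "w * (of_int p * x) \<in> I" using that Iz is_OK_moduleD(3) by blast
    then obtain y where "w * (of_int p * x) = of_int p * y" "y \<in> lat z" using Iz by blast
    moreover from this have "w * x = y" using b(1) by simp
    ultimately show ?thesis by simp
  qed
  have "{w. \<forall>x\<in>lat z. w * x \<in> lat z} = OK D"
  proof (intro equalityI subsetI)
    fix w assume "w \<in> {w. \<forall>x\<in>lat z. w * x \<in> lat z}"
    then have "w * 1 \<in> lat z" "w * z \<in> lat z" using lat_one lat_gen by blast+
    then show "w \<in> OK D" using multiplier_in_OK[OF b(1) pz] Imz by simp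
  qed (use mod in blast)
  then have "has_CM_by_OK D z" using Imz by (simp add: has_CM_by_OK_def)
  then show ?thesis using that[of z "of_int p"] Iz b(1) by simp
qed

lemma CM_module:
  assumes "has_CM_by_OK D z"
  shows "is_OK_module D (lat z)"
  using assms by (auto simp: has_CM_by_OK_def is_OK_module_def lat_zero lat_add)

lemma CM_module_cnj:
  assumes "has_CM_by_OK D z"
  shows "is_OK_module D (lat (cnj z))"
  unfolding is_OK_module_def
proof (intro conjI ballI)
  fix w x assume "w \<in> OK D" "x \<in> lat (cnj z)"
  then have "cnj w * cnj x \<in> lat z"
    using OK_cnj lat_cnj[of x "cnj z"] is_OK_moduleD(3)[OF CM_module[OF assms]] by simp
  then show "w * x \<in> lat (cnj z)" using lat_cnj by fastforce
qed (auto simp: lat_zero lat_add)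

end

lemma of_rat_eq_of_real: "of_rat x = complex_of_real (of_rat x)"
  by (induction x) (simp add: of_rat_rat)

section \<open>A CM point together with its primitive quadratic equation\<close>

locale CM_point = imaginary_quadratic +
  fixes z :: complex and a b c :: int
  assumes CM: "has_CM_by_OK D z" and quad: "quad_data z a b c"
begin

lemma a_pos: "a > 0" and gcd_abc: "gcd a (gcd b c) = 1"
  and quad_eq: "of_int a * (z * z) = - of_int b * z - of_int c"
proof -
  show "a > 0" "gcd a (gcd b c) = 1" using quad by (auto simp: quad_data_def)
  have "of_int a * (z * z) + of_int b * z + of_int c = 0"
    using quad by (simp add: quad_data_def power2_eq_square)
  then show "of_int a * (z * z) = - of_int b * z - of_int c"
    by (simp add: eq_diff_eq eq_neg_iff_add_eq_0 add.assoc add.commute add.left_commute)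
qed

lemma Im_pos: "Im z > 0"
  using CM by (simp add: has_CM_by_OK_def)

text \<open>The coefficients are real and z is not, so \<open>cnj z\<close> is the other root. This
  and \<open>root_prod\<close> are the Vieta relations, kept multiplied by a so that their right
  sides are integers.\<close>

lemma root_sum: "of_int a * z + of_int a * cnj z = - of_int b"
proof -
  have "Im z * (2 * of_int a * Re z + of_int b) = 0"
    using arg_cong[OF quad_eq, of Im] by (simp add: algebra_simps)
  then have "2 * of_int a * Re z = - of_int b" using Im_pos by simp
  then show ?thesis by (simp add: complex_eq_iff mult.commute)
qed

lemma root_prod: "of_int a * (z * cnj z) = of_int c"
proof -
  have "z * (of_int a * z + of_int a * cnj z) = - of_int b * z" using root_sum by simp
  then have "of_int a * (z * z) + of_int a * (z * cnj z) = - of_int b * z" by (simp add: algebra_simps)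
  then show ?thesis unfolding quad_eq by (simp add: algebra_simps)
qed

text \<open>If m + n z preserves the lattice, the quadratic equation forces a to divide n b and n c;
  as (a, b, c) is primitive, a divides n. Conversely a z maps z back into the lattice.\<close>

lemma OK_eq_lat_az: "OK D = lat (of_int a * z)"
proof -
  have "{w. \<forall>x\<in>lat z. w * x \<in> lat z} = lat (of_int a * z)"
  proof (intro equalityI subsetI)
    fix w assume "w \<in> {w. \<forall>x\<in>lat z. w * x \<in> lat z}"
    then have w: "w * 1 \<in> lat z" "w * z \<in> lat z" using lat_one lat_gen by blast+
    obtain m n where mn: "w = of_int m + of_int n * z" using w(1) by (auto elim: latE)
    obtain m' n' where mn': "w * z = of_int m' + of_int n' * z" using w(2) by (rule latE)
    have "of_int a * (w * z) = of_int (a * m) * z + of_int n * (of_int a * (z * z))"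
      unfolding mn by (simp add: algebra_simps)
    then have "of_int (a * m') + of_int (a * n') * z = of_int (- n * c) + of_int (a * m - n * b) * z"
      unfolding quad_eq mn' by (simp add: algebra_simps)
    then have "a * m' = - n * c \<and> a * n' = a * m - n * b"
      using Im_pos by (intro lat_coords_unique[of z]) auto
    then have "n * c = a * (- m')" "n * b = a * (m - n')" by (auto simp: algebra_simps)
    then have "a dvd n * c" "a dvd n * b" by (metis dvd_triv_left)+
    then have "a dvd gcd (n * a) (gcd (n * b) (n * c))" by simp
    then have "a dvd n" using gcd_abc by (simp add: gcd_mult_left)
    then obtain k where "n = a * k" ..
    then have "w = of_int m + of_int k * (of_int a * z)" by (simp add: mn algebra_simps)
    then show "w \<in> lat (of_int a * z)" by (simp only: latI)
  next
    fix w assume "w \<in> lat (of_int a * z)"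
    then obtain m n where mn: "w = of_int m + of_int n * (of_int a * z)" by (rule latE)
    have w1: "w \<in> lat z"
      unfolding mn by (metis latI mult.assoc of_int_mult)
    have "w * z = of_int m * z + of_int n * (of_int a * (z * z))" unfolding mn by (simp add: algebra_simps)
    also have "\<dots> = of_int (- n * c) + of_int (m - n * b) * z"
      unfolding quad_eq by (simp add: algebra_simps)
    finally have w2: "w * z \<in> lat z" by (simp only: latI)
    have "w * x \<in> lat z" if "x \<in> lat z" for x
      using that
    proof (rule latE)
      fix p q assume "x = of_int p + of_int q * z"
      then have "w * x = of_int p * w + of_int q * (w * z)" by (simp add: algebra_simps)
      then show ?thesis using w1 w2 by (simp add: lat_add lat_int_mult)
    qed
    then show "w \<in> {w. \<forall>x\<in>lat z. w * x \<in> lat z}" by blast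
  qed
  then show ?thesis using CM by (simp add: has_CM_by_OK_def)
qed

text \<open>Two bases of one ring, 1, a z and 1, omega, have equal covolume. Since both points lie
  in the upper half plane, this also fixes the sign of the square root in \<open>sqrtD_eq\<close>
  and thus leads to the discriminant formula \<open>D_eq\<close>.\<close>

lemma Im_z: "of_int a * Im z = Im \<omega>"
proof -
  have "zspan 1 (of_int a * z) = zspan 1 \<omega>"
    using OK_eq_lat_az unfolding OK_eq_lat lat_eq_zspan by simp
  from covolume_unique[OF this] show ?thesis
    using Im_pos Im_omega_pos a_pos by simp
qed

lemma sqrtD_eq: "sqrtD D = 2 * of_int a * z + of_int b"
proof (rule complex_eqI)
  show "Re (sqrtD D) = Re (2 * of_int a * z + of_int b)"
    using arg_cong[OF root_sum, of Re] by (simp add: sqrtD_def mult.commute)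
  show "Im (sqrtD D) = Im (2 * of_int a * z + of_int b)"
    using Im_z by (simp add: sqrtD_def Im_omega)
qed

lemma D_eq: "D = b * b - 4 * a * c"
proof -
  have "of_int D = (2 * of_int a * z + of_int b) * (2 * of_int a * z + of_int b)"
    using sqrtD_square unfolding sqrtD_eq by simp
  also have "\<dots> = 4 * of_int a * (of_int a * (z * z)) + 4 * of_int a * of_int b * z + of_int b * of_int b"
    by (simp add: algebra_simps)
  also have "\<dots> = of_int (b * b - 4 * a * c)"
    unfolding quad_eq by (simp add: algebra_simps)
  finally show ?thesis by (simp only: of_int_eq_iff)
qed

lemma mult_lat_cnj_in_OK:
  assumes "x \<in> lat z" "y \<in> lat (cnj z)"
  shows "of_int a * (x * y) \<in> OK D"
proof -
  obtain m n where x: "x = of_int m + of_int n * z" using assms(1) by (rule latE)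
  obtain p q where y: "y = of_int p + of_int q * cnj z" using assms(2) by (rule latE)
  have ac: "of_int a * cnj z = - of_int b - of_int a * z" using root_sum by (simp add: algebra_simps)
  have "of_int a * (x * y) = of_int (a * m * p) + of_int (m * q) * (of_int a * cnj z)
     + of_int (n * p) * (of_int a * z) + of_int (n * q) * (of_int a * (z * cnj z))"
    unfolding x y by (simp add: algebra_simps)
  also have "\<dots> = of_int (a * m * p - m * q * b + n * q * c) + of_int (n * p - m * q) * (of_int a * z)"
    unfolding root_prod ac by (simp add: algebra_simps)
  finally show ?thesis unfolding OK_eq_lat_az by (simp only: latI)
qed

text \<open>For k = l = 1 the product contains 1, z + cnj z = - b / a and z cnj z = c / a; their
  numerators over a have gcd 1, so it contains 1 / a. This is the statement that conjugate lattices
  represent inverse classes.\<close>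

lemma ideal_mult_lat_cnj:
  "ideal_mult D ((*) k ` lat z) ((*) l ` lat (cnj z)) = principal D (k * l / of_int a)"
proof (intro equalityI subsetI)
  let ?P = "principal D (k * l / of_int a)"
  fix x assume x: "x \<in> ideal_mult D ((*) k ` lat z) ((*) l ` lat (cnj z))"
  have "is_OK_module D ?P"
    unfolding principal_def by (intro is_OK_module_image_mult OK_module)
  moreover have "u * v \<in> ?P" if u: "u \<in> (*) k ` lat z" and v: "v \<in> (*) l ` lat (cnj z)" for u v
  proof -
    obtain u' v' where uv: "u = k * u'" "v = l * v'" "u' \<in> lat z" "v' \<in> lat (cnj z)"
      using u v by blast
    have "u * v = (k * l / of_int a) * (of_int a * (u' * v'))" using uv a_pos by simp
    then show ?thesis using mult_lat_cnj_in_OK[OF uv(3,4)] unfolding principal_def by blast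
  qed
  ultimately show "x \<in> ?P" using x unfolding ideal_mult_def by blast
next
  let ?P = "principal D (k * l / of_int a)"
  fix x assume "x \<in> ?P"
  then obtain o' where o': "x = (k * l / of_int a) * o'" "o' \<in> OK D" by (auto simp: principal_def)
  show "x \<in> ideal_mult D ((*) k ` lat z) ((*) l ` lat (cnj z))"
    unfolding ideal_mult_def
  proof (intro CollectI allI impI)
    fix M assume asm: "is_OK_module D M \<and> (\<forall>u\<in>(*) k ` lat z. \<forall>v\<in>(*) l ` lat (cnj z). u * v \<in> M)"
    then have M: "is_OK_module D M" by simp
    have in_M: "(k * u) * (l * v) \<in> M" if "u \<in> lat z" "v \<in> lat (cnj z)" for u v
      using asm that by blast
    have 1: "k * l \<in> M" using in_M[OF lat_one lat_one] by simp
    have 2: "k * z * l \<in> M" using in_M[OF lat_gen lat_one] by simp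
    have 3: "k * (l * cnj z) \<in> M" using in_M[OF lat_one lat_gen] by simp
    have 4: "k * z * (l * cnj z) \<in> M" using in_M[OF lat_gen lat_gen] by simp
    \<comment> \<open>A two-stage Bezout relation. Replacing a, - b and c by a times 1, the trace
      and the norm of z turns it into a formula for 1 / a in terms of products of
      generators.\<close>
    obtain s t where st: "s * a + t * gcd b c = 1" using bezout_int[of a "gcd b c"] gcd_abc by auto
    obtain s' t' where st': "s' * b + t' * c = gcd b c" using bezout_int[of b c] by blast
    have one: "s * a + t * s' * b + t * t' * c = 1"
      using st unfolding st'[symmetric] by (simp add: algebra_simps)
    have "k * l = (k * l) * of_int (s * a + t * s' * b + t * t' * c)" unfolding one by simp
    also have "\<dots> = (k * l) * (of_int s * of_int a - of_int (t * s') * (- of_int b) + of_int (t * t') * of_int c)"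
      by simp
    also have "\<dots> = of_int a * (of_int s * (k * l) - of_int (t * s') * (k * z * l + k * (l * cnj z))
       + of_int (t * t') * (k * z * (l * cnj z)))"
      unfolding root_sum[symmetric] root_prod[symmetric] by (simp add: algebra_simps)
    finally have "k * l / of_int a = of_int s * (k * l) - of_int (t * s') * (k * z * l + k * (l * cnj z))
       + of_int (t * t') * (k * z * (l * cnj z))"
      using a_pos by (simp add: divide_eq_eq mult.commute)
    also have "\<dots> \<in> M"
      by (intro is_OK_moduleD(2)[OF M] is_OK_module_diff[OF M] is_OK_module_int_mult[OF M] 1 2 3 4)
    finally have "k * l / of_int a \<in> M" .
    then have "o' * (k * l / of_int a) \<in> M" by (rule is_OK_moduleD(3)[OF M o'(2)])
    then show "x \<in> M" unfolding o'(1) by (simp only: mult.commute)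
  qed
qed

text \<open>The covolume of the ideal is |l|^2 Im z, while that of the ring is a Im z.\<close>

lemma ideal_norm_lat_cnj:
  assumes "int_ideal D ((*) l ` lat (cnj z))"
  shows "of_int a * real (ideal_norm D ((*) l ` lat (cnj z))) = (norm l)\<^sup>2"
proof -
  have "(*) l ` lat (cnj z) = zspan l (l * cnj z)" by (simp add: lat_eq_zspan image_mult_zspan)
  from ideal_norm_covolume[OF assms this]
  have "real (ideal_norm D ((*) l ` lat (cnj z))) * Im \<omega> = \<bar>Im (cnj l * l * cnj z)\<bar>"
    by (simp add: mult.assoc)
  also have "cnj l * l = complex_of_real ((norm l)\<^sup>2)"
    by (metis complex_norm_square mult.commute)
  finally have "real (ideal_norm D ((*) l ` lat (cnj z))) * (of_int a * Im z) = (norm l)\<^sup>2 * Im z"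
    using Im_pos by (simp add: Im_z abs_mult)
  then show ?thesis using Im_pos by (simp add: mult.commute mult.left_commute)
qed

text \<open>The minus sign in \<open>OmegaP\<close> turns the trace - b / a into the + b of the Gram
  matrix. Consequently \<open>gram f a b c y y\<close> is 2 f a times the squared absolute value of
  the vector as a complex number.\<close>

lemma norm_lat_vec:
  "of_int a * (norm (of_rat p - of_rat q * z))\<^sup>2
    = of_int a * (of_rat p)\<^sup>2 + of_int b * of_rat p * of_rat q + of_int c * (of_rat q)\<^sup>2"
proof -
  have "complex_of_real (of_int a * (norm (of_rat p - of_rat q * z))\<^sup>2)
     = of_int a * ((of_rat p - of_rat q * z) * cnj (of_rat p - of_rat q * z))"
    by (simp only: of_real_mult complex_norm_square of_real_of_int_eq)
  also have "cnj (of_rat p - of_rat q * z) = of_rat p - of_rat q * cnj z"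
    by (simp add: of_rat_eq_of_real)
  also have "of_int a * ((of_rat p - of_rat q * z) * (of_rat p - of_rat q * cnj z))
     = of_int a * (of_rat p)\<^sup>2 - of_rat p * of_rat q * (of_int a * z + of_int a * cnj z)
       + (of_int a * (z * cnj z)) * (of_rat q)\<^sup>2"
    by (simp add: algebra_simps power2_eq_square)
  also have "\<dots> = complex_of_real (of_int a * (of_rat p)\<^sup>2 + of_int b * of_rat p * of_rat q + of_int c * (of_rat q)\<^sup>2)"
    unfolding root_sum root_prod by (simp add: of_rat_eq_of_real)
  finally show ?thesis by (simp only: of_real_eq_iff)
qed

end

text \<open>As omega multiplies 1 into the lattice, omega = m + n z. Substituting this into the
  minimal polynomial of omega gives an integral equation for z, whose content is then divided
  out.\<close>

lemma (in imaginary_quadratic) CM_quad_data: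
  assumes "has_CM_by_OK D z"
  obtains a b c where "quad_data z a b c"
proof -
  have Imz: "Im z > 0" using assms by (simp add: has_CM_by_OK_def)
  have "\<omega> \<in> OK D" by (simp add: OK_eq_lat lat_gen)
  then have "\<omega> * 1 \<in> lat z" using assms lat_one unfolding has_CM_by_OK_def by blast
  then obtain m n where mn: "\<omega> = of_int m + of_int n * z" by (auto elim: latE)
  have n: "n \<noteq> 0"
  proof
    assume "n = 0"
    then have "Im \<omega> = 0" using arg_cong[OF mn, of Im] by simp
    then show False using Im_omega_pos by simp
  qed
  obtain e where e: "D * D - D = 4 * e" by (rule D_cong)
  define A where "A = n * n"
  define B where "B = 2 * m * n - D * n"
  define C where "C = m * m - D * m + e"
  have "of_int A * (z * z) + of_int B * z + of_int C = \<omega> * \<omega> - of_int D * \<omega> + of_int e"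
    unfolding mn A_def B_def C_def by (simp add: algebra_simps)
  also have "\<dots> = 0" unfolding omega_square[OF e] by simp
  finally have eq: "of_int A * (z * z) + of_int B * z + of_int C = 0" .
  define g where "g = gcd A (gcd B C)"
  have A: "A > 0" using n by (simp add: A_def zero_less_mult_iff) linarith
  then have g: "g > 0" by (simp add: g_def)
  obtain a b c where abc: "A = g * a" "B = g * b" "C = g * c"
    unfolding g_def by (metis dvdE gcd_dvd1 gcd_dvd2 dvd_trans)
  have "g * gcd a (gcd b c) = g"
    using g_def g unfolding abc by (simp add: gcd_mult_left abs_mult)
  then have "gcd a (gcd b c) = 1" using g by simp
  moreover have "a > 0" using A g abc by (simp add: zero_less_mult_iff)
  moreover have "of_int g * (of_int a * (z * z) + of_int b * z + of_int c) = 0"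
    using eq unfolding abc by (simp add: algebra_simps)
  then have "of_int a * z ^ 2 + of_int b * z + of_int c = 0"
    using g by (simp add: power2_eq_square)
  ultimately show ?thesis using that by (simp add: quad_data_def)
qed

section \<open>Summation and the theta space\<close>

lemma summable_on_int_exp:
  fixes r :: real
  assumes "r > 0"
  shows "(\<lambda>m::int. exp (- r * \<bar>of_int m\<bar>)) summable_on UNIV"
proof -
  have "(\<lambda>n::nat. exp (- r * real n)) summable_on UNIV"
  proof (rule summable_nonneg_imp_summable_on)
    have "exp (- r * real n) = exp (- r) ^ n" for n
      by (simp add: exp_of_nat_mult[symmetric] mult.commute)
    then show "summable (\<lambda>n. exp (- r * real n))" using assms by (simp add: summable_geometric)
  qed simp
  then have "(\<lambda>m::int. exp (- r * \<bar>of_int m\<bar>)) summable_on range int"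
    and "(\<lambda>m::int. exp (- r * \<bar>of_int m\<bar>)) summable_on range (\<lambda>n. - int n)"
    by (simp_all add: summable_on_reindex inj_on_def o_def)
  \<comment> \<open>The two ranges overlap in 0, so this is a union of sets rather than a disjoint
    sum.\<close>
  then have "(\<lambda>m::int. exp (- r * \<bar>of_int m\<bar>)) summable_on (range int \<union> range (\<lambda>n. - int n))"
    by (rule summable_on_union)
  moreover have "range int \<union> range (\<lambda>n. - int n) = UNIV"
    using int_cases2 by (auto simp: image_iff) metis
  ultimately show ?thesis by simp
qed

text \<open>Trade the Gaussian for exp (- |u|), and |u| for its lower bound (|m| + |n|) / B; the
  resulting majorant factors into two geometric series.\<close>

lemma lat_gaussian_summable:
  fixes f :: "complex \<Rightarrow> complex"
  assumes z: "Im z \<noteq> 0" and C: "C > 0"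
    and f: "\<And>u. u \<in> lat z \<Longrightarrow> norm (f u) \<le> K * (norm u * exp (- C * (norm u)\<^sup>2))"
  shows "f summable_on lat z"
proof -
  obtain B where B: "B > 0"
    "\<And>m n. \<bar>real_of_int m\<bar> + \<bar>real_of_int n\<bar> \<le> B * norm (of_int m + of_int n * z)"
    using lat_coords_bounded[OF z] by blast
  define pt where "pt = (\<lambda>(m :: int, n :: int). of_int m + of_int n * z)"
  define h where "h = (\<lambda>(m :: int, n :: int). exp (- (1 / B) * \<bar>of_int m\<bar>) * exp (- (1 / B) * \<bar>real_of_int n\<bar>))"
  \<comment> \<open>Estimate x by exp x and complete the square: the exponents differ by C x^2 - 2 x
    + 1 / C = (C x - 1)^2 / C.\<close>
  have bound: "x * exp (- C * x\<^sup>2) \<le> exp (1 / C) * exp (- x)" for x :: real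
  proof -
    have "x * exp (- C * x\<^sup>2) \<le> exp x * exp (- C * x\<^sup>2)"
      using exp_ge_add_one_self[of x] by (intro mult_right_mono) (linarith, simp)
    also have "\<dots> = exp (x - C * x\<^sup>2)" by (simp add: exp_add[symmetric])
    also have "\<dots> \<le> exp (1 / C - x)"
    proof -
      have "0 \<le> (C * x - 1)\<^sup>2 / C" using C by simp
      also have "\<dots> = C * x\<^sup>2 - 2 * x + 1 / C" using C by (simp add: power2_eq_square field_simps)
      finally show ?thesis by simp
    qed
    also have "\<dots> = exp (1 / C) * exp (- x)" by (simp add: exp_add[symmetric])
    finally show ?thesis .
  qed
  define s where "s = infsum (\<lambda>n::int. exp (- (1 / B) * \<bar>real_of_int n\<bar>)) UNIV"
  have exp_sum: "((\<lambda>n::int. exp (- (1 / B) * \<bar>real_of_int n\<bar>)) has_sum s) UNIV"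
    unfolding s_def using summable_on_int_exp[of "1 / B"] B(1) by simp
  have h_sum: "h summable_on (UNIV \<times> UNIV)"
  proof (rule summable_on_SigmaI)
    fix m :: int
    show "((\<lambda>n. h (m, n)) has_sum (exp (- (1 / B) * \<bar>of_int m\<bar>) * s)) UNIV"
      unfolding h_def using has_sum_cmult_right[OF exp_sum] by simp
    show "(\<lambda>m::int. exp (- (1 / B) * \<bar>of_int m\<bar>) * s) summable_on UNIV"
      using summable_on_int_exp[of "1 / B"] B(1) by (intro summable_on_cmult_left) simp
  qed (simp add: h_def)
  have "(\<lambda>mn. norm (f (pt mn))) summable_on (UNIV \<times> UNIV)"
  proof (rule Infinite_Sum.abs_summable_on_comparison_test')
    show "(\<lambda>mn. \<bar>K\<bar> * exp (1 / C) * h mn) summable_on (UNIV \<times> UNIV)"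
      by (rule summable_on_cmult_right[OF h_sum])
    fix mn :: "int \<times> int"
    obtain m n where mn: "mn = (m, n)" by (cases mn)
    define x where "x = norm (pt mn)"
    have "norm (f (pt mn)) \<le> K * (x * exp (- C * x\<^sup>2))"
      unfolding x_def by (rule f) (simp add: mn pt_def latI)
    also have "\<dots> \<le> \<bar>K\<bar> * (x * exp (- C * x\<^sup>2))"
      by (intro mult_right_mono) (auto simp: x_def)
    also have "\<dots> \<le> \<bar>K\<bar> * (exp (1 / C) * exp (- x))"
      by (intro mult_left_mono bound) auto
    also have "\<dots> \<le> \<bar>K\<bar> * (exp (1 / C) * h mn)"
    proof -
      have "\<bar>of_int m\<bar> + \<bar>of_int n\<bar> \<le> B * x" using B(2)[of m n] by (simp add: x_def mn pt_def)
      then have "(\<bar>of_int m\<bar> + \<bar>of_int n\<bar>) / B \<le> x" using B(1) by (simp add: pos_divide_le_eq mult.commute)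
      then have "- x \<le> - (1 / B) * \<bar>of_int m\<bar> + - (1 / B) * \<bar>of_int n\<bar>"
        by (simp add: add_divide_distrib)
      then have "exp (- x) \<le> h mn" unfolding h_def mn by (simp add: exp_add[symmetric])
      then show ?thesis by (intro mult_left_mono) auto
    qed
    finally show "norm (f (pt mn)) \<le> \<bar>K\<bar> * exp (1 / C) * h mn" by (simp add: mult.assoc)
  qed
  then have "(\<lambda>mn. f (pt mn)) summable_on (UNIV \<times> UNIV)" by (rule Infinite_Sum.abs_summable_summable)
  moreover have "bij_betw pt (UNIV \<times> UNIV) (lat z)"
  proof (rule bij_betw_imageI)
    show "inj_on pt (UNIV \<times> UNIV)"
      by (rule inj_onI) (auto simp: pt_def dest: lat_coords_unique[OF z])
    show "pt ` (UNIV \<times> UNIV) = lat z"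
      by (auto simp: pt_def lat_def image_iff)
  qed
  ultimately show ?thesis using summable_on_reindex_bij_betw[of pt "UNIV \<times> UNIV" "lat z" f] by simp
qed

lemma has_sum_finite_UN:
  fixes f :: "'a \<Rightarrow> 'b :: topological_comm_monoid_add"
  assumes "finite I" "disjoint_family_on B I" "\<And>i. i \<in> I \<Longrightarrow> (f has_sum s i) (B i)"
  shows "(f has_sum (\<Sum>i\<in>I. s i)) (\<Union>i\<in>I. B i)"
  using assms
proof (induction I rule: finite_induct)
  case (insert i I)
  have "(f has_sum (\<Sum>i\<in>I. s i)) (\<Union>i\<in>I. B i)"
    using insert.prems by (intro insert.IH) (auto simp: disjoint_family_on_def)
  moreover have "B i \<inter> B j = {}" if "j \<in> I" for j
    using disjoint_family_onD[OF insert.prems(1), of i j] that insert.hyps(2) by auto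
  then have "B i \<inter> (\<Union>i\<in>I. B i) = {}" by blast
  moreover have "(f has_sum s i) (B i)" by (rule insert.prems(2)) simp
  ultimately have "(f has_sum (s i + (\<Sum>i\<in>I. s i))) (B i \<union> (\<Union>i\<in>I. B i))"
    by (intro has_sum_Un_disjoint)
  then show ?case using insert.hyps by simp
qed simp

text \<open>Used to pass from elements to ideals: every ideal is hit by as many elements as there
  are units.\<close>

lemma has_sum_const_fibres:
  fixes g :: "'b \<Rightarrow> complex"
  assumes sum: "((\<lambda>x. g (p x)) has_sum V) X" and im: "p ` X = Y"
    and fib: "\<And>y. y \<in> Y \<Longrightarrow> card {x \<in> X. p x = y} = W" and W: "W > 0"
  shows "(g has_sum (V / of_nat W)) Y"
proof -
  define F where "F y = {x \<in> X. p x = y}" for y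
  have bij: "bij_betw snd (Sigma Y F) X"
    by (rule bij_betwI'[where f = snd]) (use im in \<open>auto simp: F_def\<close>)
  have "((\<lambda>(y, x). g (p x)) has_sum V) (Sigma Y F)"
    using has_sum_reindex_bij_betw[OF bij, of "\<lambda>x. g (p x)" V] sum by (simp add: case_prod_unfold)
  then have "((\<lambda>y. of_nat W * g y) has_sum V) Y"
  proof (rule has_sum_SigmaD)
    fix y assume y: "y \<in> Y"
    \<comment> \<open>An infinite fibre would have \<open>card\<close> 0, so positivity of W gives
      finiteness.\<close>
    have "finite (F y)" using fib[OF y] W by (metis F_def card_gt_0_iff)
    moreover have "of_nat W * g y = (\<Sum>x\<in>F y. g (p x))"
      using fib[OF y] by (simp add: F_def)
    ultimately show "((\<lambda>x. case (y, x) of (y, x) \<Rightarrow> g (p x)) has_sum of_nat W * g y) (F y)"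
      by (simp add: has_sum_finiteI)
  qed
  then have "((\<lambda>y. (1 / of_nat W) * (of_nat W * g y)) has_sum (1 / of_nat W) * V) Y"
    by (rule has_sum_cmult_right)
  then show ?thesis using W by simp
qed

section \<open>Linear closure of the theta space\<close>

lemma F_space_zero: "(\<lambda>\<tau>. 0) \<in> F_space D Zs"
  unfolding F_space_def by (intro CollectI exI[of _ "{}"]) simp

lemma F_space_gen: "h \<in> gens D Zs \<Longrightarrow> (\<lambda>\<tau>. k * h \<tau>) \<in> F_space D Zs"
  unfolding F_space_def by (intro CollectI exI[of _ "{h}"] exI[of _ "\<lambda>_. k"]) simp

lemma F_space_scale:
  assumes "g \<in> F_space D Zs"
  shows "(\<lambda>\<tau>. r * g \<tau>) \<in> F_space D Zs"
proof -
  obtain S k where "finite S" "S \<subseteq> gens D Zs" "\<forall>\<tau>. Im \<tau> > 0 \<longrightarrow> g \<tau> = (\<Sum>h\<in>S. k h * h \<tau>)"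
    using assms unfolding F_space_def by blast
  then show ?thesis unfolding F_space_def
    by (intro CollectI exI[of _ S] exI[of _ "\<lambda>h. r * k h"]) (auto simp: sum_distrib_left mult.assoc)
qed

lemma F_space_add:
  assumes "g \<in> F_space D Zs" "g' \<in> F_space D Zs"
  shows "(\<lambda>\<tau>. g \<tau> + g' \<tau>) \<in> F_space D Zs"
proof -
  obtain S k where S: "finite S" "S \<subseteq> gens D Zs" "\<And>\<tau>. Im \<tau> > 0 \<Longrightarrow> g \<tau> = (\<Sum>h\<in>S. k h * h \<tau>)"
    using assms(1) unfolding F_space_def by blast
  obtain S' k' where S': "finite S'" "S' \<subseteq> gens D Zs" "\<And>\<tau>. Im \<tau> > 0 \<Longrightarrow> g' \<tau> = (\<Sum>h\<in>S'. k' h * h \<tau>)"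
    using assms(2) unfolding F_space_def by blast
  \<comment> \<open>Both coefficient functions are extended by zero, so a generator in both sets
    receives the sum of its coefficients.\<close>
  define K where "K h = (if h \<in> S then k h else 0) + (if h \<in> S' then k' h else 0)" for h
  have "g \<tau> + g' \<tau> = (\<Sum>h\<in>S \<union> S'. K h * h \<tau>)" if "Im \<tau> > 0" for \<tau>
  proof -
    have "(\<Sum>h\<in>S \<union> S'. K h * h \<tau>) = (\<Sum>h\<in>S \<union> S'. (if h \<in> S then k h * h \<tau> else 0))
        + (\<Sum>h\<in>S \<union> S'. (if h \<in> S' then k' h * h \<tau> else 0))"
      unfolding sum.distrib[symmetric] by (rule sum.cong) (auto simp: K_def algebra_simps)
    also have "(\<Sum>h\<in>S \<union> S'. (if h \<in> S then k h * h \<tau> else 0)) = (\<Sum>h\<in>S. k h * h \<tau>)"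
      using S(1) S'(1) by (intro sum.mono_neutral_cong_right) auto
    also have "(\<Sum>h\<in>S \<union> S'. (if h \<in> S' then k' h * h \<tau> else 0)) = (\<Sum>h\<in>S'. k' h * h \<tau>)"
      using S(1) S'(1) by (intro sum.mono_neutral_cong_right) auto
    finally show ?thesis using S(3)[OF that] S'(3)[OF that] by simp
  qed
  then show ?thesis using S(1,2) S'(1,2) unfolding F_space_def
    by (intro CollectI exI[of _ "S \<union> S'"] exI[of _ K]) auto
qed

lemma F_space_sum:
  assumes "finite I" "\<And>i. i \<in> I \<Longrightarrow> g i \<in> F_space D Zs"
  shows "(\<lambda>\<tau>. \<Sum>i\<in>I. g i \<tau>) \<in> F_space D Zs"
  using assms by (induction I rule: finite_induct) (simp_all add: F_space_zero F_space_add)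

text \<open>Membership only constrains values on the upper half plane; elsewhere
  \<open>infsum\<close> may return a default value.\<close>

lemma F_space_cong:
  assumes "g \<in> F_space D Zs" "\<And>\<tau>. Im \<tau> > 0 \<Longrightarrow> g' \<tau> = g \<tau>"
  shows "g' \<in> F_space D Zs"
proof -
  obtain S k where "finite S" "S \<subseteq> gens D Zs" "\<forall>\<tau>. Im \<tau> > 0 \<longrightarrow> g \<tau> = (\<Sum>h\<in>S. k h * h \<tau>)"
    using assms(1) unfolding F_space_def by blast
  then show ?thesis unfolding F_space_def using assms(2)
    by (intro CollectI exI[of _ S] exI[of _ k]) auto
qed

section \<open>Coset sums as lattice theta functions\<close>

lemma ideal_mult_subset:
  assumes "is_OK_module D I" "J \<subseteq> OK D"
  shows "ideal_mult D I J \<subseteq> I"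
proof
  fix x assume "x \<in> ideal_mult D I J"
  moreover have "u * v \<in> I" if "u \<in> I" "v \<in> J" for u v
    using is_OK_moduleD(3)[OF assms(1), of v u] that assms(2) by (auto simp: mult.commute)
  ultimately show "x \<in> I" using assms(1) unfolding ideal_mult_def by blast
qed

lemma ideal_mult_subset_right:
  assumes "is_OK_module D J" "I \<subseteq> OK D"
  shows "ideal_mult D I J \<subseteq> J"
proof
  fix x assume "x \<in> ideal_mult D I J"
  moreover have "u * v \<in> J" if "u \<in> I" "v \<in> J" for u v
    using is_OK_moduleD(3)[OF assms(1), of u v] that assms(2) by auto
  ultimately show "x \<in> J" using assms(1) unfolding ideal_mult_def by blast
qed

lemma int_idealD:
  assumes "int_ideal D I"
  shows "is_OK_module D I" "I \<subseteq> OK D"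
  using assms by (simp_all add: int_ideal_def)

context imaginary_quadratic
begin

lemma principal_self: "\<alpha> \<in> principal D \<alpha>"
  unfolding principal_def using OK_one by force

lemma coprime_idealI:
  assumes "is_OK_module D I" "I \<subseteq> OK D" "is_OK_module D cf" "cf \<subseteq> OK D"
    and "x \<in> I" "1 - x \<in> cf"
  shows "coprime_ideal D I cf"
  unfolding coprime_ideal_def ideal_add_def
proof (intro equalityI subsetI)
  fix y assume "y \<in> {x + y |x y. x \<in> I \<and> y \<in> cf}"
  then show "y \<in> OK D" using assms(2,4) is_OK_moduleD(2)[OF OK_module] by blast
next
  fix y assume y: "y \<in> OK D"
  have "y = y * x + y * (1 - x)" by (simp add: algebra_simps)
  then show "y \<in> {x + y |x y. x \<in> I \<and> y \<in> cf}"
    using is_OK_moduleD(3)[OF assms(1) y assms(5)] is_OK_moduleD(3)[OF assms(3) y assms(6)] by blast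
qed

lemma coprime_idealE:
  assumes "coprime_ideal D I cf"
  obtains x where "x \<in> I" "1 - x \<in> cf"
proof -
  have "1 \<in> ideal_add I cf" using assms OK_one by (simp add: coprime_ideal_def)
  then obtain x y where "1 = x + y" "x \<in> I" "y \<in> cf" by (auto simp: ideal_add_def)
  moreover from this have "1 - x = y" by (simp add: algebra_simps)
  ultimately show ?thesis using that by simp
qed

text \<open>Write I as the quotient of I by the unit ideal.\<close>

lemma frac_prime_toI:
  assumes "int_ideal D I" "coprime_ideal D I cf" "int_ideal D cf"
  shows "frac_prime_to D cf I"
proof -
  note I = int_idealD[OF assms(1)]
  have "I \<subseteq> Kfield D"
  proof
    fix x assume "x \<in> I"
    then have "x \<in> lat \<omega>" using I(2) by (auto simp: OK_eq_lat)
    then obtain m n where x: "x = of_int m + of_int n * \<omega>" by (rule latE)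
    have "x = of_rat (of_int m + of_int n * of_int D / 2) + of_rat (of_int n / 2) * sqrtD D"
      unfolding x by (simp add: omegaK_def of_rat_add of_rat_mult of_rat_divide field_simps)
    then show "x \<in> Kfield D" unfolding Kfield_def by blast
  qed
  moreover have "(*) 1 ` I = I" by simp
  ultimately have frac: "frac_ideal D I"
    unfolding frac_ideal_def using I(1) assms(1) OK_one by (intro conjI bexI[of _ 1]) auto
  have OK: "int_ideal D (OK D)"
    unfolding int_ideal_def
  proof (intro conjI OK_module subset_refl notI)
    assume "OK D = {0}"
    then show False using OK_one by simp
  qed
  have "ideal_mult D (OK D) I = I"
  proof (intro equalityI)
    show "ideal_mult D (OK D) I \<subseteq> I" by (rule ideal_mult_subset_right[OF I(1) subset_refl])
    show "I \<subseteq> ideal_mult D (OK D) I"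
    proof
      fix x assume "x \<in> I"
      then have "1 * x \<in> ideal_mult D (OK D) I" using OK_one unfolding ideal_mult_def by blast
      then show "x \<in> ideal_mult D (OK D) I" by simp
    qed
  qed
  moreover have "coprime_ideal D (OK D) cf"
    using int_idealD[OF assms(3)] is_OK_moduleD(1)[OF int_idealD(1)[OF assms(3)]]
    by (intro coprime_idealI[where x = 1] OK_module OK_one) simp_all
  ultimately show ?thesis unfolding frac_prime_to_def using frac assms OK by blast
qed

text \<open>A unit preserves the covolume of the ring, hence has absolute value 1, and the closed
  unit disc contains finitely many lattice points.\<close>

lemma units_finite: "finite {\<epsilon>. (*) \<epsilon> ` OK D = OK D}"
proof (rule finite_subset[OF _ finite_lat_bounded[of \<omega> 1]])
  show "{\<epsilon>. (*) \<epsilon> ` OK D = OK D} \<subseteq> {x \<in> lat \<omega>. norm x \<le> 1}"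
  proof clarify
    fix \<epsilon> assume eq: "(*) \<epsilon> ` OK D = OK D"
    have "\<epsilon> * 1 \<in> OK D" using eq OK_one by blast
    moreover have "zspan \<epsilon> (\<epsilon> * \<omega>) = zspan 1 \<omega>"
      using eq by (simp add: OK_eq_lat lat_eq_zspan image_mult_zspan)
    from covolume_unique[OF this] have "\<bar>Im (cnj \<epsilon> * \<epsilon> * \<omega>)\<bar> = Im \<omega>"
      using Im_omega_pos by (simp add: mult.assoc)
    then have "\<bar>Im (complex_of_real ((norm \<epsilon>)\<^sup>2) * \<omega>)\<bar> = Im \<omega>"
      by (metis complex_norm_square mult.commute)
    then have "(norm \<epsilon>)\<^sup>2 = 1" using Im_omega_pos by (simp add: abs_mult)
    then have "norm \<epsilon> = 1" by (metis norm_ge_zero one_power2 power2_eq_imp_eq zero_le_one)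
    ultimately show "\<epsilon> \<in> lat \<omega> \<and> norm \<epsilon> \<le> 1" by (simp add: OK_eq_lat)
  qed
qed (use Im_omega_pos in simp)

lemma unit_image_module:
  assumes "(*) \<epsilon> ` OK D = OK D" "is_OK_module D M"
  shows "(*) \<epsilon> ` M = M"
proof (intro equalityI subsetI)
  have "\<epsilon> * 1 \<in> OK D" using assms(1) OK_one by blast
  then have e: "\<epsilon> \<in> OK D" by simp
  obtain \<delta> where \<delta>: "\<delta> \<in> OK D" "\<epsilon> * \<delta> = 1" using assms(1) OK_one by (metis imageE)
  fix x
  show "x \<in> M" if "x \<in> (*) \<epsilon> ` M" using that is_OK_moduleD(3)[OF assms(2) e] by blast
  show "x \<in> (*) \<epsilon> ` M" if "x \<in> M"
  proof -
    have "\<delta> * x \<in> M" using is_OK_moduleD(3)[OF assms(2) \<delta>(1) that] .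
    moreover have "x = \<epsilon> * (\<delta> * x)" using \<delta>(2) by (simp flip: mult.assoc)
    ultimately show ?thesis by blast
  qed
qed

lemma principal_eq_unit:
  assumes "principal D \<alpha> = principal D \<beta>" "\<alpha> \<noteq> 0"
  shows "(*) (\<beta> / \<alpha>) ` OK D = OK D"
proof -
  have "(*) (\<beta> / \<alpha>) ` OK D = (*) (1 / \<alpha>) ` principal D \<beta>"
    by (simp add: principal_def image_image)
  also have "\<dots> = (*) (1 / \<alpha>) ` principal D \<alpha>" by (simp add: assms(1))
  also have "\<dots> = OK D" using assms(2) by (simp add: principal_def image_image)
  finally show ?thesis .
qed

end

lemma Re_of_rat: "Re (of_rat x) = of_rat x" and Im_of_rat: "Im (of_rat x) = 0"
  by (simp_all add: of_rat_eq_of_real)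

section \<open>Dual vectors and coset sums\<close>

context CM_point
begin

lemma lattL_in_dualL: "y \<in> lattL \<Longrightarrow> y \<in> dualL f a b c"
  unfolding dualL_def lattL_def gram_def by (auto intro!: Ints_mult Ints_add)

lemma dualL_add: "y \<in> dualL f a b c \<Longrightarrow> y' \<in> dualL f a b c \<Longrightarrow> y + y' \<in> dualL f a b c"
proof -
  assume "y \<in> dualL f a b c" "y' \<in> dualL f a b c"
  moreover have "gram f a b c (y + y') x = gram f a b c y x + gram f a b c y' x" for x
    by (simp add: gram_def algebra_simps)
  ultimately show ?thesis unfolding dualL_def by (auto intro: Ints_add)
qed

text \<open>
  The witness comes from 1 / sqrt(D) = (2 a z + b) / D: the coordinates of
  (m + n z) / (f sqrt(D)) are ((b m - 2 c n) / (f D), (2 a m - b n) / (f D)).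
\<close>

lemma dualL_vector:
  fixes f :: nat and m n :: int
  assumes "f \<ge> 1"
  obtains y0 where "y0 \<in> dualL f a b c"
    "of_nat f * sqrtD D * (of_rat (fst y0) - of_rat (snd y0) * z) = of_int m + of_int n * z"
proof
  let ?N = "of_nat f * of_int D :: rat"
  define p where "p = of_int (b * m - 2 * c * n) / ?N"
  \<comment> \<open>The sign is opposite to that of the z coordinate, because vectors are read as x2
    - x1 z.\<close>
  define q where "q = of_int (b * n - 2 * a * m) / ?N"
  have N: "?N \<noteq> 0" using assms D_neg by simp
  have Np: "?N * p = of_int (b * m - 2 * c * n)" and Nq: "?N * q = of_int (b * n - 2 * a * m)"
    using N by (simp_all add: p_def q_def)
  have Dr: "(of_int D :: rat) = of_int b * of_int b - 4 * of_int a * of_int c"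
    by (simp add: D_eq)
  have D0: "(of_int D :: rat) \<noteq> 0" using D_neg by simp
  \<comment> \<open>The pairings of (p, q) with e2 and e1 come out as n and m, after the common
    factor D = b^2 - 4 a c is cancelled.\<close>
  have "of_int D * (of_nat f * (2 * of_int a * p + of_int b * q)) = (2 * of_int a * (?N * p) + of_int b * (?N * q))"
    by (simp add: algebra_simps)
  also have "\<dots> = of_int D * of_int n"
    unfolding Np Nq unfolding Dr by (simp add: algebra_simps)
  finally have 1: "of_nat f * (2 * of_int a * p + of_int b * q) = of_int n" using D0 by simp
  have "of_int D * (of_nat f * (of_int b * p + 2 * of_int c * q)) = (of_int b * (?N * p) + 2 * of_int c * (?N * q))"
    by (simp add: algebra_simps)
  also have "\<dots> = of_int D * of_int m"
    unfolding Np Nq unfolding Dr by (simp add: algebra_simps)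
  finally have 2: "of_nat f * (of_int b * p + 2 * of_int c * q) = of_int m" using D0 by simp
  show "(p, q) \<in> dualL f a b c"
    unfolding dualL_def lattL_def
  proof clarify
    fix i j :: int
    have "gram f a b c (p, q) (of_int i, of_int j)
       = (of_nat f * (2 * of_int a * p + of_int b * q)) * of_int i
       + (of_nat f * (of_int b * p + 2 * of_int c * q)) * of_int j"
      by (simp add: gram_def algebra_simps)
    also have "\<dots> = of_int (n * i + m * j)" unfolding 1 2 by simp
    finally show "gram f a b c (p, q) (of_int i, of_int j) \<in> \<int>" by simp
  qed
  have NpC: "of_nat f * of_int D * of_rat p = (of_int (b * m - 2 * c * n) :: complex)"
    using arg_cong[OF Np, of "of_rat :: rat \<Rightarrow> complex"] by (simp add: of_rat_mult of_rat_diff)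
  have NqC: "of_nat f * of_int D * of_rat q = (of_int (b * n - 2 * a * m) :: complex)"
    using arg_cong[OF Nq, of "of_rat :: rat \<Rightarrow> complex"] by (simp add: of_rat_mult of_rat_diff)
  have "sqrtD D * (of_nat f * sqrtD D * (of_rat p - of_rat q * z))
     = of_nat f * (sqrtD D * sqrtD D) * of_rat p - of_nat f * (sqrtD D * sqrtD D) * of_rat q * z"
    by (simp add: algebra_simps)
  also have "\<dots> = of_int (b * m - 2 * c * n) - of_int (b * n - 2 * a * m) * z"
    unfolding sqrtD_square NpC NqC ..
  also have "\<dots> = of_int (b * m) + of_int (2 * a * m + b * n) * z + 2 * of_int n * (- of_int b * z - of_int c)"
    by (simp add: algebra_simps)
  also have "\<dots> = (2 * of_int a * z + of_int b) * (of_int m + of_int n * z)"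
    unfolding quad_eq[symmetric] by (simp add: algebra_simps)
  also have "\<dots> = sqrtD D * (of_int m + of_int n * z)" by (simp add: sqrtD_eq)
  finally show "of_nat f * sqrtD D * (of_rat (fst (p, q)) - of_rat (snd (p, q)) * z) = of_int m + of_int n * z"
    using sqrtD_nonzero by simp
qed

lemma norm_sqrtD: "(norm (sqrtD D))\<^sup>2 = of_int \<bar>D\<bar>"
  using D_neg by (simp add: sqrtD_def norm_mult)

text \<open>Scaling by s k with s = f sqrt(D) carries a coset of the lattice inside its dual onto a
  coset of s k \<open>lat z\<close> inside k \<open>lat z\<close>. If u is the complex number of a
  dual vector, the exponent on the ideal side is 2 pi i tau f^2 |D| a |u|^2, which equals pi i (f
  |D| tau) (2 f a |u|^2), the exponent in \<open>fa\<close>.\<close>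

lemma coset_sum_eq_fa:
  fixes f :: nat
  assumes f: "f \<ge> 1" and k: "k \<noteq> 0" and \<alpha>: "\<alpha> \<in> (*) k ` lat z"
  obtains y0 where "y0 \<in> dualL f a b c"
    "\<And>\<tau>. infsum (\<lambda>\<beta>. \<beta> * exp (2 * pi * \<i> * \<tau> * of_real (of_int a * (norm \<beta>)\<^sup>2 / (norm k)\<^sup>2)))
        {\<beta> \<in> (*) k ` lat z. \<beta> - \<alpha> \<in> (*) (of_nat f * sqrtD D * k) ` lat z}
      = of_nat f * sqrtD D * k / of_real (sqrt (2 * of_int a * real f)) * fa D f a b c z y0 \<tau>"
proof -
  define s where "s = of_nat f * sqrtD D"
  have s0: "s \<noteq> 0" using f sqrtD_nonzero by (simp add: s_def)
  obtain u where u: "\<alpha> = k * u" "u \<in> lat z" using \<alpha> by blast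
  obtain m n where "u = of_int m + of_int n * z" using u(2) by (rule latE)
  with u(1) have mn: "\<alpha> = k * (of_int m + of_int n * z)" by simp
  obtain y0 where y0: "y0 \<in> dualL f a b c"
    "s * (of_rat (fst y0) - of_rat (snd y0) * z) = of_int m + of_int n * z"
    unfolding s_def by (rule dualL_vector[OF f])
  define h where "h y = s * k * (of_rat (fst y) - of_rat (snd y) * z)" for y
  have h_add: "h (y + y') = h y + h y'" for y y' by (simp add: h_def of_rat_add algebra_simps)
  have hy0: "h y0 = \<alpha>" using y0(2) by (simp add: h_def mn mult.commute mult.left_commute)
  define Y where "Y = {y \<in> dualL f a b c. y - y0 \<in> lattL}"
  define C where "C = {\<beta> \<in> (*) k ` lat z. \<beta> - \<alpha> \<in> (*) (s * k) ` lat z}"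
  have s_OK: "s \<in> OK D"
    using is_OK_module_int_mult[OF OK_module sqrtD_in_OK, of "int f"] by (simp add: s_def)
  have h_latt: "h (of_int i, of_int j) = s * k * (of_int i + of_int (- j) * z)" for i j
    by (simp add: h_def)
  have inj: "inj_on h Y"
  proof (rule inj_onI)
    fix y y' assume "h y = h y'"
    then have eq: "of_rat (fst y) - of_rat (snd y) * z = of_rat (fst y') - of_rat (snd y') * z"
      using s0 k by (simp add: h_def)
    have "of_rat (snd y) * Im z = of_rat (snd y') * Im z"
      using arg_cong[OF eq, of Im] by (simp add: Re_of_rat Im_of_rat)
    then have "snd y = snd y'" using Im_pos by simp
    then show "y = y'" using eq by (simp add: prod_eq_iff)
  qed
  have img: "h ` Y = C"
  proof (intro equalityI subsetI)
    fix \<beta> assume "\<beta> \<in> h ` Y"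
    then obtain y where y: "y \<in> Y" "\<beta> = h y" by blast
    obtain i j where ij: "y - y0 = (of_int i, of_int j)" using y(1) by (auto simp: Y_def lattL_def)
    have "\<beta> = h (y0 + (y - y0))" by (simp add: y(2))
    also have "\<dots> = \<alpha> + s * k * (of_int i + of_int (- j) * z)" by (simp only: h_add hy0 ij h_latt)
    finally have \<beta>: "\<beta> = \<alpha> + s * k * (of_int i + of_int (- j) * z)" .
    have l: "of_int i + of_int (- j) * z \<in> lat z" by (rule latI)
    then have "s * (of_int i + of_int (- j) * z) \<in> lat z"
      by (rule is_OK_moduleD(3)[OF CM_module[OF CM] s_OK])
    then have "(of_int m + of_int n * z) + s * (of_int i + of_int (- j) * z) \<in> lat z"
      by (intro lat_add latI)
    moreover have "\<beta> = k * ((of_int m + of_int n * z) + s * (of_int i + of_int (- j) * z))"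
      unfolding \<beta> mn by (simp add: algebra_simps)
    ultimately have "\<beta> \<in> (*) k ` lat z" by blast
    moreover have "\<beta> - \<alpha> \<in> (*) (s * k) ` lat z" unfolding \<beta> add_diff_cancel_left' using l by (rule imageI)
    ultimately show "\<beta> \<in> C" by (simp add: C_def)
  next
    fix \<beta> assume "\<beta> \<in> C"
    then obtain v where v: "\<beta> - \<alpha> = s * k * v" "v \<in> lat z" unfolding C_def by blast
    obtain i j where "v = of_int i + of_int j * z" using v(2) by (rule latE)
    with v(1) have "\<beta> - \<alpha> = s * k * (of_int i + of_int j * z)" by simp
    then have "\<beta> = \<alpha> + h (of_int i, of_int (- j))" unfolding h_latt by (simp add: algebra_simps)
    then have "\<beta> = h (y0 + (of_int i, of_int (- j)))" by (simp add: h_add hy0)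
    moreover have l: "(of_int i, of_int (- j)) \<in> lattL" unfolding lattL_def by blast
    then have "y0 + (of_int i, of_int (- j)) \<in> Y"
      unfolding Y_def using dualL_add[OF y0(1) lattL_in_dualL[OF l]] by simp
    ultimately show "\<beta> \<in> h ` Y" by blast
  qed
  have "infsum (\<lambda>\<beta>. \<beta> * exp (2 * pi * \<i> * \<tau> * of_real (of_int a * (norm \<beta>)\<^sup>2 / (norm k)\<^sup>2))) C
      = s * k / of_real (sqrt (2 * of_int a * real f)) * fa D f a b c z y0 \<tau>" for \<tau>
  proof -
    define R where "R = complex_of_real (sqrt (2 * of_int a * real f))"
    have R0: "R \<noteq> 0" using a_pos f by (simp add: R_def)
    define g where "g \<beta> = \<beta> * exp (2 * pi * \<i> * \<tau> * of_real (of_int a * (norm \<beta>)\<^sup>2 / (norm k)\<^sup>2))" for \<beta>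
    have gh: "g (h y) = s * k / R * (OmegaP f a z y * exp (pi * \<i> * (of_nat f * of_int \<bar>D\<bar> * \<tau>) * of_rat (gram f a b c y y)))" for y
    proof -
      define u where "u = of_rat (fst y) - of_rat (snd y) * z"
      have "(norm (h y))\<^sup>2 = (real f)\<^sup>2 * of_int \<bar>D\<bar> * (norm k)\<^sup>2 * (norm u)\<^sup>2"
        unfolding h_def s_def u_def[symmetric]
        by (simp add: norm_mult power_mult_distrib norm_sqrtD)
      then have "of_int a * (norm (h y))\<^sup>2 / (norm k)\<^sup>2 = (real f)\<^sup>2 * of_int \<bar>D\<bar> * (of_int a * (norm u)\<^sup>2)"
        using k by simp
      moreover have "of_rat (gram f a b c y y) = complex_of_real (2 * real f * (of_int a * (norm u)\<^sup>2))"
        unfolding u_def norm_lat_vec gram_def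
        by (simp add: of_rat_mult of_rat_add of_rat_eq_of_real[symmetric] algebra_simps power2_eq_square)
      ultimately have "2 * pi * \<i> * \<tau> * of_real (of_int a * (norm (h y))\<^sup>2 / (norm k)\<^sup>2)
        = pi * \<i> * (of_nat f * of_int \<bar>D\<bar> * \<tau>) * of_rat (gram f a b c y y)"
        using D_neg by (simp add: power2_eq_square abs_of_neg)
      then have "g (h y) = h y * exp (pi * \<i> * (of_nat f * of_int \<bar>D\<bar> * \<tau>) * of_rat (gram f a b c y y))"
        unfolding g_def by (simp only:)
      moreover have "h y = s * k / R * OmegaP f a z y"
        using R0 unfolding h_def OmegaP_def R_def[symmetric] by simp
      ultimately show ?thesis by (simp only: mult.assoc)
    qed
    \<comment> \<open>Reindexing along an injection and extracting a constant are valid for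
      \<open>infsum\<close> as a total function, so the identity holds for every tau.\<close>
    have "infsum g C = infsum (\<lambda>y. g (h y)) Y"
      unfolding img[symmetric] using infsum_reindex[OF inj, of g] by (simp add: o_def)
    also have "\<dots> = s * k / R * fa D f a b c z y0 \<tau>"
      unfolding gh fa_def theta_lat_def Y_def by (rule infsum_cmult_right')
    finally show ?thesis unfolding g_def R_def .
  qed
  then show ?thesis using that[OF y0(1)] unfolding C_def s_def by blast
qed

end

section \<open>The theta series of an ideal class\<close>

context CM_point
begin

text \<open>The integer N = f |D| equals - s sqrt(D), hence N times the lattice lies in s times it,
  and coordinates only matter modulo N.\<close>

lemma finite_cosets:
  fixes f :: nat and k :: complex
  assumes f: "f \<ge> 1"
  defines "cl \<equiv> \<lambda>\<alpha>. {\<beta> \<in> (*) k ` lat z. \<beta> - \<alpha> \<in> (*) (of_nat f * sqrtD D * k) ` lat z}"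
  shows "finite (cl ` (*) k ` lat z)"
proof -
  define s where "s = of_nat f * sqrtD D"
  define N where "N = int f * \<bar>D\<bar>"
  have N: "N > 0" using f D_neg unfolding N_def by (intro mult_pos_pos) auto
  have M: "is_OK_module D ((*) (s * k) ` lat z)"
    by (intro is_OK_module_image_mult CM_module CM)
  have sN: "k * (of_int N * u) \<in> (*) (s * k) ` lat z" if "u \<in> lat z" for u
  proof -
    have "of_int N = - (s * sqrtD D)"
      using D_neg sqrtD_square by (simp add: N_def s_def mult.assoc)
    then have "k * (of_int N * u) = s * k * (- (sqrtD D * u))" by (simp add: algebra_simps)
    moreover have "- (sqrtD D * u) \<in> lat z"
      using is_OK_moduleD(3)[OF CM_module[OF CM] sqrtD_in_OK that] by (rule lat_uminus)
    ultimately show ?thesis by blast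
  qed
  have cl_eq: "cl \<alpha> = cl \<alpha>'" if "\<alpha>' - \<alpha> \<in> (*) (s * k) ` lat z" for \<alpha> \<alpha>'
  proof -
    have "\<beta> - \<alpha> \<in> (*) (s * k) ` lat z \<longleftrightarrow> \<beta> - \<alpha>' \<in> (*) (s * k) ` lat z" for \<beta>
      using is_OK_module_diff[OF M _ that, of "\<beta> - \<alpha>"] is_OK_moduleD(2)[OF M _ that, of "\<beta> - \<alpha>'"] by auto
    then show ?thesis unfolding cl_def s_def[symmetric] by simp
  qed
  have "cl ` (*) k ` lat z \<subseteq> (\<lambda>(i, j). cl (k * (of_int i + of_int j * z))) ` ({0..<N} \<times> {0..<N})"
  proof (clarify)
    fix u assume "u \<in> lat z"
    then obtain m n where u: "u = of_int m + of_int n * z" by (rule latE)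
    define i where "i = m mod N"
    define j where "j = n mod N"
    have m: "m = N * (m div N) + i" and n: "n = N * (n div N) + j" by (simp_all add: i_def j_def)
    have "u = of_int (N * (m div N) + i) + of_int (N * (n div N) + j) * z"
      using m n u by simp
    then have "k * u - k * (of_int i + of_int j * z) = k * (of_int N * (of_int (m div N) + of_int (n div N) * z))"
      by (simp add: algebra_simps)
    then have "k * u - k * (of_int i + of_int j * z) \<in> (*) (s * k) ` lat z"
      by (simp only: sN latI)
    then have "cl (k * u) = cl (k * (of_int i + of_int j * z))" by (rule cl_eq[symmetric])
    moreover have "(i, j) \<in> {0..<N} \<times> {0..<N}" using N by (simp add: i_def j_def)
    ultimately show "cl (k * u) \<in> (\<lambda>(i, j). cl (k * (of_int i + of_int j * z))) ` ({0..<N} \<times> {0..<N})"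
      by (intro image_eqI[of _ _ "(i, j)"]) simp_all
  qed
  then show ?thesis by (rule finite_subset) simp
qed

lemma theta_summable:
  assumes "Im \<tau> > 0" "k \<noteq> 0"
  shows "(\<lambda>\<beta>. \<beta> * exp (2 * pi * \<i> * \<tau> * of_real (of_int a * (norm \<beta>)\<^sup>2 / (norm k)\<^sup>2)))
    summable_on ((*) k ` lat z)"
proof -
  have inj: "inj_on ((*) k) (lat z)" using assms(2) by (simp add: inj_on_def)
  have "(\<lambda>u. k * u * exp (2 * pi * \<i> * \<tau> * of_real (of_int a * (norm (k * u))\<^sup>2 / (norm k)\<^sup>2))) summable_on lat z"
  proof (rule lat_gaussian_summable)
    show "Im z \<noteq> 0" using Im_pos by simp
    show "2 * pi * Im \<tau> * of_int a > 0" using assms(1) a_pos by simp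
    fix u
    show "norm (k * u * exp (2 * pi * \<i> * \<tau> * of_real (of_int a * (norm (k * u))\<^sup>2 / (norm k)\<^sup>2)))
      \<le> norm k * (norm u * exp (- (2 * pi * Im \<tau> * of_int a) * (norm u)\<^sup>2))"
    proof -
      have e: "of_int a * (norm (k * u))\<^sup>2 / (norm k)\<^sup>2 = of_int a * (norm u)\<^sup>2"
        using assms(2) by (simp add: norm_mult power_mult_distrib)
      have "Re (2 * pi * \<i> * \<tau> * of_real (of_int a * (norm u)\<^sup>2)) = - (2 * pi * Im \<tau> * of_int a) * (norm u)\<^sup>2"
        by simp
      then show ?thesis unfolding e unfolding norm_mult norm_exp_eq_Re
        by (simp only: mult.assoc order_refl)
    qed
  qed
  then show ?thesis by (simp add: summable_on_reindex[OF inj] o_def)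
qed

lemma class_theta_in_F_space:
  assumes z: "z \<in> Zs" and hecke: "hecke_mod D cf \<phi> chr"
  defines "T \<equiv> {I. int_ideal D I \<and> (\<exists>l. l \<noteq> 0 \<and> I = (*) l ` lat (cnj z))}"
  defines "summand \<equiv> \<lambda>\<tau> I. (if coprime_ideal D I cf then \<phi> I else 0) * exp (2 * pi * \<i> * \<tau> * of_nat (ideal_norm D I))"
  shows "\<exists>g\<in>F_space D Zs. \<forall>\<tau>. Im \<tau> > 0 \<longrightarrow> (summand \<tau> has_sum g \<tau>) T"
proof (cases "\<exists>I\<in>T. coprime_ideal D I cf")
  case False
  then have "(summand \<tau> has_sum 0) T" for \<tau>
    by (intro has_sum_0) (auto simp: summand_def)
  then show ?thesis by (intro bexI[OF _ F_space_zero]) simp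
next
  case True
  then obtain I0 l0 where I0: "int_ideal D I0" "l0 \<noteq> 0" "I0 = (*) l0 ` lat (cnj z)" "coprime_ideal D I0 cf"
    unfolding T_def by blast
  have cf: "int_ideal D cf" and dir: "dir_char D cf chr" using hecke by (auto simp: hecke_mod_def)
  note cf_mod = int_idealD(1)[OF cf] and cf_sub = int_idealD(2)[OF cf]
  \<comment> \<open>This x0 will generate A I0, so it has to be nonzero. If the given witness is 0,
    then 1 lies in \<open>cf\<close>, every element is congruent to 1, and \<open>l0\<close> serves
    instead.\<close>
  have "\<exists>x0\<in>I0. x0 \<noteq> 0 \<and> 1 - x0 \<in> cf"
  proof -
    obtain x where x: "x \<in> I0" "1 - x \<in> cf" using coprime_idealE[OF I0(4)] by blast
    show ?thesis
    proof (cases "x = 0")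
      case True
      have l0: "l0 \<in> I0" using I0(3) lat_one by force
      then have "1 - l0 \<in> OK D"
        using int_idealD[OF I0(1)] OK_one is_OK_module_diff[OF OK_module] by blast
      then have "(1 - l0) * 1 \<in> cf" by (rule is_OK_moduleD(3)[OF cf_mod]) (use True x(2) in simp)
      then show ?thesis using l0 I0(2) by auto
    qed (use x in blast)
  qed
  then obtain x0 where x0: "x0 \<in> I0" "x0 \<noteq> 0" "1 - x0 \<in> cf" by blast
  obtain v where v: "v \<in> lat (cnj z)" "x0 = l0 * v" using x0(1) I0(3) by blast
  \<comment> \<open>Chosen so that k l0 / a = x0; then \<open>ideal_mult_lat_cnj\<close> gives A I0
    = (x0).\<close>
  define k where "k = of_int a * v"
  have k0: "k \<noteq> 0" using x0(2) v(2) a_pos by (simp add: k_def)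
  define A where "A = (*) k ` lat z"
  have A_mod: "is_OK_module D A"
    unfolding A_def by (intro is_OK_module_image_mult CM_module CM)
  have A_sub: "A \<subseteq> OK D"
    using mult_lat_cnj_in_OK[OF _ v(1)] by (auto simp: A_def k_def mult.assoc mult.commute mult.left_commute)
  have "k \<in> A" unfolding A_def using lat_one by force
  then have A: "int_ideal D A" using A_mod A_sub k0 by (auto simp: int_ideal_def)
  have "k * l0 / of_int a = x0" using a_pos by (simp add: k_def v(2))
  then have "ideal_mult D A I0 = principal D x0" unfolding A_def I0(3) ideal_mult_lat_cnj by simp
  then have "x0 \<in> A"
    using ideal_mult_subset[OF A_mod int_idealD(2)[OF I0(1)]] principal_self[of x0] by blast
  then have A_cop: "coprime_ideal D A cf"
    by (intro coprime_idealI[OF A_mod A_sub cf_mod cf_sub _ x0(3)])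
  have \<phi>A: "\<phi> A \<noteq> 0" using hecke frac_prime_toI[OF A A_cop cf] by (simp add: hecke_mod_def)

  \<comment> \<open>The ideal alpha / A, with the inverse of A written through the conjugate
    lattice.\<close>
  define idl where "idl \<alpha> = (*) (\<alpha> * of_int a / k) ` lat (cnj z)" for \<alpha>
  have A_idl: "ideal_mult D A (idl \<alpha>) = principal D \<alpha>" for \<alpha>
    unfolding A_def idl_def ideal_mult_lat_cnj using k0 a_pos by simp
  have idl_mod: "is_OK_module D (idl \<alpha>)" for \<alpha>
    unfolding idl_def by (intro is_OK_module_image_mult CM_module_cnj CM)
  have idl_int: "int_ideal D (idl \<alpha>)" if "\<alpha> \<in> A" "\<alpha> \<noteq> 0" for \<alpha>
  proof -
    obtain u where u: "u \<in> lat z" "\<alpha> = k * u" using \<open>\<alpha> \<in> A\<close> by (auto simp: A_def)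
    have "\<alpha> * of_int a / k * w \<in> OK D" if "w \<in> lat (cnj z)" for w
      using mult_lat_cnj_in_OK[OF u(1) that] k0 by (simp add: u(2) mult.assoc mult.commute mult.left_commute)
    then have "idl \<alpha> \<subseteq> OK D" unfolding idl_def by blast
    moreover have "\<alpha> * of_int a / k * 1 \<in> idl \<alpha>" unfolding idl_def using lat_one by blast
    moreover have "\<alpha> * of_int a / k * 1 \<noteq> 0" using that(2) k0 a_pos by simp
    ultimately have "idl \<alpha> \<subseteq> OK D" "idl \<alpha> \<noteq> {0}" by (blast, metis singletonD)
    then show ?thesis using idl_mod by (simp add: int_ideal_def)
  qed
  have idl_norm: "real (ideal_norm D (idl \<alpha>)) = of_int a * (norm \<alpha>)\<^sup>2 / (norm k)\<^sup>2"
    if "\<alpha> \<in> A" "\<alpha> \<noteq> 0" for \<alpha>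
  proof -
    have "of_int a * real (ideal_norm D (idl \<alpha>)) = (norm (\<alpha> * of_int a / k))\<^sup>2"
      using ideal_norm_lat_cnj idl_int[OF that] unfolding idl_def by blast
    also have "\<dots> = of_int a * (of_int a * (norm \<alpha>)\<^sup>2 / (norm k)\<^sup>2)"
      by (simp add: norm_mult norm_divide power_mult_distrib power_divide power2_eq_square)
    finally have "of_int a * real (ideal_norm D (idl \<alpha>)) = of_int a * (of_int a * (norm \<alpha>)\<^sup>2 / (norm k)\<^sup>2)" .
    moreover have "real_of_int a \<noteq> 0" using a_pos by simp
    ultimately show ?thesis by (rule mult_left_cancel[THEN iffD1, rotated])
  qed
  have idl_image: "idl ` (A - {0}) = T"
  proof (intro equalityI subsetI)
    fix I assume "I \<in> idl ` (A - {0})"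
    then obtain \<alpha> where "\<alpha> \<in> A" "\<alpha> \<noteq> 0" "I = idl \<alpha>" by blast
    moreover from this have "\<alpha> * of_int a / k \<noteq> 0" using k0 a_pos by simp
    ultimately show "I \<in> T" unfolding T_def using idl_int idl_def by blast
  next
    fix I assume "I \<in> T"
    then obtain l where l: "int_ideal D I" "l \<noteq> 0" "I = (*) l ` lat (cnj z)" unfolding T_def by blast
    \<comment> \<open>The generator of A I; it lies in A because A I does.\<close>
    define \<alpha> where "\<alpha> = k * l / of_int a"
    have "\<alpha> \<noteq> 0" "idl \<alpha> = I" using k0 l a_pos by (simp_all add: \<alpha>_def idl_def)
    moreover have "\<alpha> \<in> A"
      using ideal_mult_subset[OF A_mod int_idealD(2)[OF l(1)]] A_idl[of \<alpha>] principal_self[of \<alpha>]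
        \<open>idl \<alpha> = I\<close> by blast
    ultimately show "I \<in> idl ` (A - {0})" by blast
  qed
  define U where "U = {\<epsilon>. (*) \<epsilon> ` OK D = OK D}"
  have U_card: "card U > 0"
    unfolding U_def card_gt_0_iff using units_finite by (auto intro: exI[of _ 1])
  \<comment> \<open>Multiplying \<open>idl\<close> of alpha by A recovers the principal ideal of
    alpha, so a fibre is exactly one orbit under the units.\<close>
  have fibre: "card {\<beta> \<in> A - {0}. idl \<beta> = I} = card U" if "I \<in> T" for I
  proof -
    obtain \<alpha> where \<alpha>: "\<alpha> \<in> A" "\<alpha> \<noteq> 0" "I = idl \<alpha>" using \<open>I \<in> T\<close> idl_image by blast
    have "bij_betw (\<lambda>\<epsilon>. \<epsilon> * \<alpha>) U {\<beta> \<in> A - {0}. idl \<beta> = I}"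
    proof (rule bij_betw_imageI)
      show "inj_on (\<lambda>\<epsilon>. \<epsilon> * \<alpha>) U" using \<alpha>(2) by (simp add: inj_on_def)
      show "(\<lambda>\<epsilon>. \<epsilon> * \<alpha>) ` U = {\<beta> \<in> A - {0}. idl \<beta> = I}"
      proof (intro equalityI subsetI)
        fix \<beta> assume "\<beta> \<in> (\<lambda>\<epsilon>. \<epsilon> * \<alpha>) ` U"
        then obtain \<epsilon> where \<epsilon>: "(*) \<epsilon> ` OK D = OK D" "\<beta> = \<epsilon> * \<alpha>" by (auto simp: U_def)
        have "\<beta> \<in> A" using unit_image_module[OF \<epsilon>(1) A_mod] \<alpha>(1) \<epsilon>(2) by blast
        moreover have "\<epsilon> \<noteq> 0" using \<epsilon>(1) OK_one by (metis imageE mult_zero_left zero_neq_one)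
        then have "\<beta> \<noteq> 0" using \<alpha>(2) \<epsilon>(2) by simp
        moreover have "idl \<beta> = (*) \<epsilon> ` idl \<alpha>"
          unfolding idl_def \<epsilon>(2) image_image by (simp add: mult.assoc)
        then have "idl \<beta> = I" using unit_image_module[OF \<epsilon>(1) idl_mod] \<alpha>(3) by simp
        ultimately show "\<beta> \<in> {\<beta> \<in> A - {0}. idl \<beta> = I}" by simp
      next
        fix \<beta> assume \<beta>: "\<beta> \<in> {\<beta> \<in> A - {0}. idl \<beta> = I}"
        then have "idl \<beta> = idl \<alpha>" using \<alpha>(3) by simp
        then have "principal D \<alpha> = principal D \<beta>" using A_idl by metis
        then have "\<beta> / \<alpha> \<in> U" using principal_eq_unit \<alpha>(2) by (simp add: U_def)
        moreover have "\<beta> = \<beta> / \<alpha> * \<alpha>" using \<alpha>(2) by simp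
        ultimately show "\<beta> \<in> (\<lambda>\<epsilon>. \<epsilon> * \<alpha>) ` U" by blast
      qed
    qed
    then show ?thesis by (metis bij_betw_same_card)
  qed
  have princ: "is_OK_module D (principal D \<alpha>) \<and> principal D \<alpha> \<subseteq> OK D" if "\<alpha> \<in> A" for \<alpha>
    unfolding principal_def using is_OK_module_image_mult[OF OK_module] OK_mult that A_sub by blast
  \<comment> \<open>As A is prime to \<open>cf\<close>, the ideals I and A I are prime to it
    simultaneously: the product of two witnesses congruent to 1 is again one.\<close>
  have idl_cop: "coprime_ideal D (idl \<alpha>) cf \<longleftrightarrow> coprime_ideal D (principal D \<alpha>) cf"
    if "\<alpha> \<in> A" "\<alpha> \<noteq> 0" for \<alpha>
  proof
    assume "coprime_ideal D (idl \<alpha>) cf"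
    then obtain x where x: "x \<in> idl \<alpha>" "1 - x \<in> cf" by (rule coprime_idealE)
    obtain y where y: "y \<in> A" "1 - y \<in> cf" using A_cop by (rule coprime_idealE)
    have "y * x \<in> principal D \<alpha>" unfolding A_idl[symmetric] ideal_mult_def using x y by blast
    moreover have eq: "1 - y * x = (1 - y) + y * (1 - x)" by (simp add: algebra_simps)
    have "1 - y * x \<in> cf"
      unfolding eq using is_OK_moduleD(2)[OF cf_mod y(2) is_OK_moduleD(3)[OF cf_mod _ x(2), of y]] y(1) A_sub
      by blast
    ultimately show "coprime_ideal D (principal D \<alpha>) cf"
      using coprime_idealI princ[OF that(1)] cf_mod cf_sub by blast
  next
    assume "coprime_ideal D (principal D \<alpha>) cf"
    then obtain x where x: "x \<in> principal D \<alpha>" "1 - x \<in> cf" by (rule coprime_idealE)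
    have "x \<in> idl \<alpha>" using ideal_mult_subset_right[OF idl_mod A_sub] x(1) A_idl by blast
    then show "coprime_ideal D (idl \<alpha>) cf"
      using coprime_idealI[OF idl_mod int_idealD(2)[OF idl_int[OF that]] cf_mod cf_sub _ x(2)] by blast
  qed
  \<comment> \<open>This collects the finite part of the character; the remaining factor alpha stays
    in \<open>q\<close> as the linear weight of the theta function.\<close>
  define \<psi> where "\<psi> \<alpha> = (if coprime_ideal D (principal D \<alpha>) cf then chr \<alpha> / \<phi> A else 0)" for \<alpha>
  define q where "q \<tau> \<alpha> = \<alpha> * exp (2 * pi * \<i> * \<tau> * of_real (of_int a * (norm \<alpha>)\<^sup>2 / (norm k)\<^sup>2))" for \<tau> \<alpha>
  have summand_idl: "summand \<tau> (idl \<alpha>) = \<psi> \<alpha> * q \<tau> \<alpha>" if "\<alpha> \<in> A" "\<alpha> \<noteq> 0" for \<tau> \<alpha>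
  proof (cases "coprime_ideal D (principal D \<alpha>) cf")
    case True
    then have cop: "coprime_ideal D (idl \<alpha>) cf" using idl_cop[OF that] by simp
    have "elt_prime_to D cf \<alpha>" using True that A_sub by (auto simp: elt_prime_to_def)
    then have "\<alpha> * chr \<alpha> = \<phi> (ideal_mult D A (idl \<alpha>))"
      using hecke unfolding A_idl by (simp add: hecke_mod_def)
    also have "\<dots> = \<phi> A * \<phi> (idl \<alpha>)"
      using hecke frac_prime_toI[OF A A_cop cf] frac_prime_toI[OF idl_int[OF that] cop cf]
      by (simp add: hecke_mod_def)
    finally have "\<phi> (idl \<alpha>) = \<alpha> * chr \<alpha> / \<phi> A" using \<phi>A by simp
    moreover have "complex_of_nat (ideal_norm D (idl \<alpha>)) = of_real (of_int a * (norm \<alpha>)\<^sup>2 / (norm k)\<^sup>2)"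
      unfolding idl_norm[OF that, symmetric] by simp
    ultimately show ?thesis unfolding summand_def \<psi>_def q_def using cop True by simp
  next
    case False
    then show ?thesis using idl_cop[OF that] by (simp add: summand_def \<psi>_def)
  qed

  obtain f' :: int where f': "f' > 0" "of_int f' \<in> cf" by (rule int_ideal_pos_int[OF cf])
  define f where "f = nat f'"
  have f: "f \<ge> 1" "of_nat f \<in> cf" using f' by (simp_all add: f_def of_nat_nat)
  define s where "s = of_nat f * sqrtD D"
  define L where "L = (*) (s * k) ` lat z"
  have L_mod: "is_OK_module D L"
    unfolding L_def by (intro is_OK_module_image_mult CM_module CM)
  \<comment> \<open>L is f sqrt(D) A, and f lies in \<open>cf\<close> while sqrt(D) A is integral;
    so a coset of L determines the residue modulo \<open>cf\<close>.\<close>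
  have L_cf: "x \<in> cf" if "x \<in> L" for x
  proof -
    obtain u where u: "u \<in> lat z" "x = s * k * u" using \<open>x \<in> L\<close> by (auto simp: L_def)
    have "k * u \<in> OK D" using u(1) A_sub A_def by blast
    then have "sqrtD D * (k * u) \<in> OK D" using OK_mult sqrtD_in_OK by blast
    then have "sqrtD D * (k * u) * of_nat f \<in> cf" using is_OK_moduleD(3)[OF cf_mod _ f(2)] by blast
    then show ?thesis using u(2) by (simp add: s_def mult.assoc mult.commute mult.left_commute)
  qed
  have prin_cong: "coprime_ideal D (principal D \<beta>) cf"
    if "\<alpha> \<in> A" "\<beta> \<in> A" "\<beta> - \<alpha> \<in> cf" "coprime_ideal D (principal D \<alpha>) cf" for \<alpha> \<beta>
  proof -
    obtain x where x: "x \<in> principal D \<alpha>" "1 - x \<in> cf" using \<open>coprime_ideal D (principal D \<alpha>) cf\<close> by (rule coprime_idealE)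
    obtain w where w: "w \<in> OK D" "x = \<alpha> * w" using x(1) by (auto simp: principal_def)
    have eq: "1 - \<beta> * w = (1 - x) - w * (\<beta> - \<alpha>)" by (simp add: w(2) algebra_simps)
    have "1 - \<beta> * w \<in> cf"
      unfolding eq by (rule is_OK_module_diff[OF cf_mod x(2) is_OK_moduleD(3)[OF cf_mod w(1) that(3)]])
    moreover have "\<beta> * w \<in> principal D \<beta>" using w(1) unfolding principal_def by (rule imageI)
    ultimately show ?thesis using coprime_idealI princ[OF that(2)] cf_mod cf_sub by blast
  qed
  have \<psi>_cong: "\<psi> \<alpha> = \<psi> \<beta>" if "\<alpha> \<in> A" "\<beta> \<in> A" "\<alpha> \<noteq> 0" "\<beta> \<noteq> 0" "\<beta> - \<alpha> \<in> L" for \<alpha> \<beta>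
  proof -
    have ba: "\<beta> - \<alpha> \<in> cf" using L_cf that(5) .
    have "- 1 * (\<beta> - \<alpha>) \<in> cf" using is_OK_module_int_mult[OF cf_mod ba, of "-1"] by simp
    then have ab: "\<alpha> - \<beta> \<in> cf" by simp
    have iff: "coprime_ideal D (principal D \<alpha>) cf \<longleftrightarrow> coprime_ideal D (principal D \<beta>) cf"
      using prin_cong that(1,2) ba ab by blast
    moreover have "chr \<alpha> = chr \<beta>" if "coprime_ideal D (principal D \<alpha>) cf"
    proof -
      have "elt_prime_to D cf \<alpha>" "elt_prime_to D cf \<beta>"
        using that iff \<open>\<alpha> \<in> A\<close> \<open>\<beta> \<in> A\<close> \<open>\<alpha> \<noteq> 0\<close> \<open>\<beta> \<noteq> 0\<close> A_sub by (auto simp: elt_prime_to_def)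
      then show ?thesis using dir ab by (simp add: dir_char_def)
    qed
    ultimately show ?thesis by (simp add: \<psi>_def)
  qed
  define cl where "cl \<alpha> = {\<beta> \<in> A. \<beta> - \<alpha> \<in> L}" for \<alpha>
  have cl_fin: "finite (cl ` A)"
    using finite_cosets[OF f(1), of k] unfolding cl_def A_def L_def s_def .
  have cl_Union: "(\<Union>C\<in>cl ` A. C) = A"
    using is_OK_moduleD(1)[OF L_mod] by (auto simp: cl_def)
  have cl_disj: "disjoint_family_on (\<lambda>C. C) (cl ` A)"
    unfolding disjoint_family_on_def
  proof (intro ballI impI)
    fix C C' assume "C \<in> cl ` A" "C' \<in> cl ` A" and ne: "C \<noteq> C'"
    then obtain \<alpha> \<alpha>' where \<alpha>: "C = cl \<alpha>" "C' = cl \<alpha>'" by blast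
    show "C \<inter> C' = {}"
    proof (rule ccontr)
      assume "C \<inter> C' \<noteq> {}"
      then obtain \<gamma> where \<gamma>: "\<gamma> - \<alpha> \<in> L" "\<gamma> - \<alpha>' \<in> L" unfolding \<alpha> cl_def by blast
      have d: "\<alpha>' - \<alpha> \<in> L" using is_OK_module_diff[OF L_mod \<gamma>] by simp
      have "\<beta> - \<alpha> \<in> L \<longleftrightarrow> \<beta> - \<alpha>' \<in> L" for \<beta>
        using is_OK_module_diff[OF L_mod _ d, of "\<beta> - \<alpha>"] is_OK_moduleD(2)[OF L_mod _ d, of "\<beta> - \<alpha>'"] by auto
      then have "C = C'" unfolding \<alpha> cl_def by simp
      then show False using ne by simp
    qed
  qed
  have "\<exists>g\<in>F_space D Zs. \<forall>\<tau>. Im \<tau> > 0 \<longrightarrow> ((\<lambda>\<beta>. \<psi> \<beta> * q \<tau> \<beta>) has_sum g \<tau>) C" if "C \<in> cl ` A" for C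
  proof -
    obtain \<alpha> where \<alpha>: "\<alpha> \<in> A" "C = cl \<alpha>" using \<open>C \<in> cl ` A\<close> by blast
    \<comment> \<open>The value at 0 is left aside because \<open>elt_prime_to\<close> only speaks
      of nonzero elements; the term there vanishes through the weight anyway.\<close>
    have "\<exists>\<kappa>. \<forall>\<beta>\<in>C. \<beta> \<noteq> 0 \<longrightarrow> \<psi> \<beta> = \<kappa>"
    proof (cases "\<exists>\<beta>\<in>C. \<beta> \<noteq> 0")
      case True
      then obtain \<beta> where \<beta>: "\<beta> \<in> C" "\<beta> \<noteq> 0" by blast
      have "\<psi> \<gamma> = \<psi> \<beta>" if "\<gamma> \<in> C" "\<gamma> \<noteq> 0" for \<gamma>
      proof (rule \<psi>_cong)
        have "\<beta> - \<alpha> \<in> L" "\<gamma> - \<alpha> \<in> L" using that \<beta> by (auto simp: \<alpha>(2) cl_def)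
        from is_OK_module_diff[OF L_mod this] show "\<beta> - \<gamma> \<in> L" by simp
      qed (use that \<beta> in \<open>auto simp: \<alpha>(2) cl_def\<close>)
      then show ?thesis by blast
    qed blast
    then obtain \<kappa> where \<kappa>: "\<And>\<beta>. \<beta> \<in> C \<Longrightarrow> \<beta> \<noteq> 0 \<Longrightarrow> \<psi> \<beta> = \<kappa>" by blast
    obtain y0 where y0: "y0 \<in> dualL f a b c"
      "\<And>\<tau>. infsum (q \<tau>) C = s * k / of_real (sqrt (2 * of_int a * real f)) * fa D f a b c z y0 \<tau>"
      unfolding q_def \<alpha>(2) cl_def A_def L_def s_def
      using coset_sum_eq_fa[OF f(1) k0 \<alpha>(1)[unfolded A_def]] by blast
    have gen: "fa D f a b c z y0 \<in> gens D Zs"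
      unfolding gens_def using f(1) z quad y0(1) by blast
    define K where "K = \<kappa> * (s * k / of_real (sqrt (2 * of_int a * real f)))"
    have "((\<lambda>\<beta>. \<psi> \<beta> * q \<tau> \<beta>) has_sum (K * fa D f a b c z y0 \<tau>)) C" if \<tau>: "Im \<tau> > 0" for \<tau>
    proof -
      have "q \<tau> summable_on A" unfolding q_def A_def by (rule theta_summable[OF \<tau> k0])
      moreover have "C \<subseteq> A" by (auto simp: \<alpha>(2) cl_def)
      ultimately have "q \<tau> summable_on C" by (rule summable_on_subset_banach)
      then have "(q \<tau> has_sum infsum (q \<tau>) C) C" by simp
      then have "((\<lambda>\<beta>. \<kappa> * q \<tau> \<beta>) has_sum (K * fa D f a b c z y0 \<tau>)) C"
        using has_sum_cmult_right[of "q \<tau>" C "infsum (q \<tau>) C" \<kappa>] by (simp add: y0(2) K_def mult.assoc)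
      moreover have "\<psi> \<beta> * q \<tau> \<beta> = \<kappa> * q \<tau> \<beta>" if "\<beta> \<in> C" for \<beta>
        using \<kappa>[OF that] by (cases "\<beta> = 0") (auto simp: q_def)
      ultimately show ?thesis using has_sum_cong[of C "\<lambda>\<beta>. \<psi> \<beta> * q \<tau> \<beta>" "\<lambda>\<beta>. \<kappa> * q \<tau> \<beta>"] by blast
    qed
    then show ?thesis by (intro bexI[OF _ F_space_gen[OF gen, of K]]) blast
  qed
  then obtain g where g: "\<And>C. C \<in> cl ` A \<Longrightarrow> g C \<in> F_space D Zs"
    "\<And>C \<tau>. C \<in> cl ` A \<Longrightarrow> Im \<tau> > 0 \<Longrightarrow> ((\<lambda>\<beta>. \<psi> \<beta> * q \<tau> \<beta>) has_sum g C \<tau>) C" by metis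
  define G where "G \<tau> = (\<Sum>C\<in>cl ` A. g C \<tau>)" for \<tau>
  have "(summand \<tau> has_sum (G \<tau> / of_nat (card U))) T" if \<tau>: "Im \<tau> > 0" for \<tau>
  proof (rule has_sum_const_fibres[OF _ idl_image fibre U_card])
    have "((\<lambda>\<beta>. \<psi> \<beta> * q \<tau> \<beta>) has_sum G \<tau>) (\<Union>C\<in>cl ` A. C)"
      unfolding G_def by (rule has_sum_finite_UN[OF cl_fin cl_disj g(2)[OF _ \<tau>]])
    then have "((\<lambda>\<beta>. \<psi> \<beta> * q \<tau> \<beta>) has_sum G \<tau>) A" unfolding cl_Union .
    \<comment> \<open>The point 0, present in A but giving no ideal, contributes \<open>q\<close> at
      0, which is 0.\<close>
    then show "((\<lambda>\<beta>. summand \<tau> (idl \<beta>)) has_sum G \<tau>) (A - {0})"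
      by (subst has_sum_cong_neutral[where T = A and g = "\<lambda>\<beta>. \<psi> \<beta> * q \<tau> \<beta>"])
        (auto simp: summand_idl q_def)
  qed
  moreover have "(\<lambda>\<tau>. G \<tau> / of_nat (card U)) \<in> F_space D Zs"
  proof -
    have "G \<in> F_space D Zs" unfolding G_def by (rule F_space_sum[OF cl_fin g(1)])
    from F_space_scale[OF this, of "1 / of_nat (card U)"] show ?thesis by simp
  qed
  ultimately show ?thesis by (intro bexI[where x = "\<lambda>\<tau>. G \<tau> / of_nat (card U)"]) auto
qed

end

section \<open>Assembling the ideal classes\<close>

lemma (in imaginary_quadratic) int_ideal_cnj:
  assumes "int_ideal D I"
  shows "int_ideal D (cnj ` I)"
proof -
  note I = int_idealD[OF assms]
  have "is_OK_module D (cnj ` I)"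
    unfolding is_OK_module_def
  proof (intro conjI ballI)
    show "0 \<in> cnj ` I" using is_OK_moduleD(1)[OF I(1)] by force
  next
    fix x y assume "x \<in> cnj ` I" "y \<in> cnj ` I"
    then obtain x' y' where "x = cnj x'" "y = cnj y'" "x' \<in> I" "y' \<in> I" by blast
    then show "x + y \<in> cnj ` I"
      using is_OK_moduleD(2)[OF I(1), of x' y'] by (metis complex_cnj_add imageI)
  next
    fix w x assume w: "w \<in> OK D" and "x \<in> cnj ` I"
    then obtain x' where "x = cnj x'" "x' \<in> I" by blast
    then show "w * x \<in> cnj ` I"
      using is_OK_moduleD(3)[OF I(1) OK_cnj[OF w], of x']
      by (metis complex_cnj_cnj complex_cnj_mult imageI)
  qed
  moreover have "cnj ` I \<subseteq> OK D" using I(2) OK_cnj by blast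
  moreover have "cnj ` I \<noteq> {0}"
  proof
    assume "cnj ` I = {0}"
    then have "cnj ` cnj ` I = {0}" by simp
    then show False using assms by (simp add: image_image int_ideal_def)
  qed
  ultimately show ?thesis by (simp add: int_ideal_def)
qed

text \<open>Apply \<open>int_ideal_CM\<close> to the conjugate ideal and conjugate back, so that the
  representative appears as \<open>cnj w\<close>, the form in which classes are summed.\<close>

lemma (in imaginary_quadratic) int_ideal_class:
  assumes "CM_reps D Zs" "int_ideal D I"
  obtains w l where "w \<in> Zs" "l \<noteq> 0" "I = (*) l ` lat (cnj w)"
proof -
  obtain z l where z: "has_CM_by_OK D z" "l \<noteq> 0" "cnj ` I = (*) l ` lat z"
    by (rule int_ideal_CM[OF int_ideal_cnj[OF assms(2)]])
  obtain w where w: "w \<in> Zs" "homothetic z w" using assms(1) z(1) unfolding CM_reps_def by blast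
  then obtain l' where l': "l' \<noteq> 0" "lat w = (*) l' ` lat z" by (auto simp: homothetic_def)
  have "I = cnj ` cnj ` I" by (simp add: image_image)
  also have "\<dots> = (\<lambda>x. cnj (l * x)) ` lat z" unfolding z(3) by (simp add: image_image)
  also have "\<dots> = (*) (cnj (l / l')) ` lat (cnj w)"
    unfolding lat_cnj_eq l'(2) image_image using l'(1) by simp
  finally show ?thesis using that[OF w(1), of "cnj (l / l')"] z(2) l'(1) by simp
qed

theorem theorem4p2p2:
  fixes d :: int and Zs :: "complex set" and c :: "complex set" and \<phi> :: "complex set \<Rightarrow> complex"
  assumes "d < 0" and "squarefree d"
    and "CM_reps (disc d) Zs"
    and "hecke_char_cond (disc d) c \<phi>"
  shows "hecke_theta (disc d) c \<phi> \<in> F_space (disc d) Zs"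
proof -
  define D where "D = disc d"
  interpret imaginary_quadratic d D by standard (use assms(1,2) D_def in auto)
  have reps: "CM_reps D Zs" using assms(3) by (simp add: D_def)
  then have fin: "finite Zs" by (simp add: CM_reps_def)
  obtain chr where hecke: "hecke_mod D c \<phi> chr"
    using assms(4) unfolding hecke_char_cond_def D_def by blast
  define T where "T w = {I. int_ideal D I \<and> (\<exists>l. l \<noteq> 0 \<and> I = (*) l ` lat (cnj w))}" for w
  define summand where "summand \<tau> I = (if coprime_ideal D I c then \<phi> I else 0)
    * exp (2 * pi * \<i> * \<tau> * of_nat (ideal_norm D I))" for \<tau> I
  have "\<exists>g\<in>F_space D Zs. \<forall>\<tau>. Im \<tau> > 0 \<longrightarrow> (summand \<tau> has_sum g \<tau>) (T w)" if w: "w \<in> Zs" for w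
  proof -
    have CM: "has_CM_by_OK D w" using reps w by (simp add: CM_reps_def)
    obtain a' b' c' where q: "quad_data w a' b' c'" by (rule CM_quad_data[OF CM])
    interpret CM_point d D w a' b' c' by standard (fact CM, fact q)
    show ?thesis
      using class_theta_in_F_space[OF w hecke] unfolding T_def summand_def .
  qed
  then obtain g where g: "\<And>w. w \<in> Zs \<Longrightarrow> g w \<in> F_space D Zs"
    "\<And>w \<tau>. w \<in> Zs \<Longrightarrow> Im \<tau> > 0 \<Longrightarrow> (summand \<tau> has_sum g w \<tau>) (T w)" by metis
  have T_Union: "(\<Union>w\<in>Zs. T w) = {I. int_ideal D I}"
  proof (intro equalityI subsetI)
    fix I assume "I \<in> {I. int_ideal D I}"
    then have I: "int_ideal D I" by simp
    obtain w l where "w \<in> Zs" "l \<noteq> 0" "I = (*) l ` lat (cnj w)" by (rule int_ideal_class[OF reps I])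
    then show "I \<in> (\<Union>w\<in>Zs. T w)" using I unfolding T_def by blast
  qed (auto simp: T_def)
  have T_disj: "disjoint_family_on T Zs"
    unfolding disjoint_family_on_def
  proof (intro ballI impI)
    \<comment> \<open>An ideal in both classes would make w and w' homothetic, so w would have two
      representatives in \<open>Zs\<close>.\<close>
    fix w w' assume w: "w \<in> Zs" "w' \<in> Zs" "w \<noteq> w'"
    show "T w \<inter> T w' = {}"
    proof (rule ccontr)
      assume "T w \<inter> T w' \<noteq> {}"
      then obtain l l' where l: "l \<noteq> 0" "l' \<noteq> 0" "(*) l ` lat (cnj w) = (*) l' ` lat (cnj w')"
        unfolding T_def by blast
      have "lat w' = cnj ` (*) (1 / l') ` (*) l' ` lat (cnj w')"
        using l(2) by (simp add: lat_cnj_eq image_image)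
      also have "\<dots> = (*) (cnj (l / l')) ` lat w"
        unfolding l(3)[symmetric] by (simp add: lat_cnj_eq image_image)
      finally have "homothetic w w'"
        unfolding homothetic_def using l(1,2) by (intro exI[of _ "cnj (l / l')"]) simp
      moreover have "homothetic w w" unfolding homothetic_def by (intro exI[of _ 1]) simp
      ultimately show False using reps w unfolding CM_reps_def by blast
    qed
  qed
  have theta: "hecke_theta D c \<phi> \<tau> = (\<Sum>w\<in>Zs. g w \<tau>)" if \<tau>: "Im \<tau> > 0" for \<tau>
  proof -
    have "(summand \<tau> has_sum (\<Sum>w\<in>Zs. g w \<tau>)) {I. int_ideal D I}"
      using has_sum_finite_UN[OF fin T_disj g(2)[OF _ \<tau>]] unfolding T_Union .
    then show ?thesis unfolding hecke_theta_def summand_def by (rule infsumI)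
  qed
  have "hecke_theta D c \<phi> \<in> F_space D Zs"
    by (rule F_space_cong[OF F_space_sum[OF fin g(1)] theta])
  then show ?thesis by (simp only: D_def)
qed

end
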